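(* Let $\alpha,\beta,\gamma$ be real constants with $\alpha,\gamma<0$, and let $(u_0,v_0)\in H^1(\mathbb{R})\times H^1(\mathbb{R})$. Let $(u,v)$ be the corresponding global solution, with initial condition $(u_0,v_0)$, of the Schrödinger–Korteweg–de Vries system $$\begin{cases} i\partial_t u+\partial_x^2 u=\alpha uv+\beta u|u|^2,\\ \partial_t v+\partial_x^3 v+v\,\partial_x v=\gamma\,\partial_x(|u|^2),\\ u(x,0)=u_0(x),\quad v(x,0)=v_0(x).\end{cases}$$ Let $0<p_1<\frac23$ and $0<m<1-\frac{p_1}{2}$, let $C>0$ be any constant, and set $\Gamma_{p_1}(t)=\{x\in\mathbb{R} : |x-t^m|\le C\,t^{p_1}\}$. Then $$\liminf_{t\uparrow\infty}\int_{\Gamma_{p_1}(t)} (v(t,x))^2\,\mathrm{d}x=\liminf_{t\uparrow\infty}\int_{\Gamma_{p_1}(t)}|u(t,x)|^2\,\mathrm{d}x=0.$$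
   Context: Here $x\in\mathbb{R}$ is the space variable, $t$ is time, $u$ is complex-valued and $v$ is real-valued; $u(t,x)$ and $u(x,t)$ denote the same value. Spaces: for $k,s\in\mathbb{R}$ and $b\in(0,1)$, $X^{k,b}$ and $Y^{s,b}$ are the completions of the Schwartz space $\mathcal{S}(\mathbb{R}^2)$ under the norms $$\|f\|_{X^{k,b}}=\Big(\iint\langle\xi\rangle^{2k}\langle\tau+\xi^2\rangle^{2b}|\widehat f(\xi,\tau)|^2\,d\tau\,d\xi\Big)^{1/2},\qquad \|f\|_{Y^{s,b}}=\Big(\iint\langle\xi\rangle^{2s}\langle\tau-\xi^3\rangle^{2b}|\widehat f(\xi,\tau)|^2\,d\tau\,d\xi\Big)^{1/2},$$ where $\langle y\rangle=(1+|y|^2)^{1/2}$ and $\widehat f$ is the Fourier transform in the variables $x,t$. Solution: it is known (Corcho–Linares) that for $(u_0,v_0)\in H^1(\mathbb{R})\times H^1(\mathbb{R})$ there are $T>0$ and a unique solution $(u,v)$ on $[0,T]$ with $u,v\in C([0,T];H^1(\mathbb{R}))$ such that, after multiplication by a smooth time cutoff equal to $1$ on $[0,T]$, $u\in X^{1,b}$ and $v\in Y^{1,b}$ for some $b>\frac12$ close to $\frac12$; the solution depends locally Lipschitz-continuously on the data. If moreover $\alpha\gamma>0$, this solution extends to all $T>0$ and satisfies $\sup_{t}\big(\|u(t)\|_{H^1}+\|v(t)\|_{H^1}\big)\le\Psi(\|u_0\|_{H^1},\|v_0\|_{H^1})$ for a function $\Psi$ depending only on the two norms. "The corresponding solution"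 means this global solution. *)

theory Defs
  imports "HOL-Analysis.Analysis"
begin

text \<open>
  Functions of space and time are curried with time first: \<open>u t x\<close>.
  Elements of \<open>L\<^sup>2\<close> and of Sobolev spaces are represented by arbitrary Borel
  representatives of their almost-everywhere classes.
\<close>

section \<open>Smooth functions of one and of two real variables\<close>

definition smooth1 :: "(real \<Rightarrow> real) \<Rightarrow> bool" where
  "smooth1 \<phi> \<longleftrightarrow> (\<forall>n. (deriv ^^ n) \<phi> differentiable_on UNIV)"

definition test_fun1 :: "(real \<Rightarrow> real) \<Rightarrow> bool" where
  "test_fun1 \<phi> \<longleftrightarrow> smooth1 \<phi> \<and> bounded {x. \<phi> x \<noteq> 0}"

definition pd_t :: "(real \<Rightarrow> real \<Rightarrow> 'a::real_normed_vector) \<Rightarrow> real \<Rightarrow> real \<Rightarrow> 'a" where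
  "pd_t f = (\<lambda>t x. vector_derivative (\<lambda>s. f s x) (at t))"

definition pd_x :: "(real \<Rightarrow> real \<Rightarrow> 'a::real_normed_vector) \<Rightarrow> real \<Rightarrow> real \<Rightarrow> 'a" where
  "pd_x f = (\<lambda>t x. vector_derivative (\<lambda>y. f t y) (at x))"

text \<open>
  It suffices to consider the partial derivatives taken in the order "first \<open>x\<close>, then \<open>t\<close>":
  by Schwarz's theorem the remaining mixed derivatives exist and agree with these.
\<close>

definition smooth2 :: "(real \<Rightarrow> real \<Rightarrow> 'a::real_normed_vector) \<Rightarrow> bool" where
  "smooth2 f \<longleftrightarrow> (\<forall>j k. let g = (pd_t ^^ j) ((pd_x ^^ k) f) in
      continuous_on UNIV (\<lambda>(t, x). g t x) \<and>
      (\<forall>t x. (\<lambda>s. g s x) differentiable (at t)) \<and>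
      (\<forall>t x. (\<lambda>y. g t y) differentiable (at x)))"

definition schwartz2 :: "(real \<Rightarrow> real \<Rightarrow> complex) \<Rightarrow> bool" where
  "schwartz2 f \<longleftrightarrow> smooth2 f \<and>
     (\<forall>j k m n. bounded (range (\<lambda>(t, x). (t ^ m * x ^ n) *\<^sub>R (pd_t ^^ j) ((pd_x ^^ k) f) t x)))"

text \<open>Real test functions in \<open>C\<^sub>c\<^sup>\<infinity>((0,T) \<times> \<real>)\<close>.\<close>

definition test_fun2 :: "real \<Rightarrow> (real \<Rightarrow> real \<Rightarrow> real) \<Rightarrow> bool" where
  "test_fun2 T \<phi> \<longleftrightarrow> smooth2 \<phi> \<and>
     (\<exists>K. compact K \<and> K \<subseteq> {0<..<T} \<times> UNIV \<and> (\<forall>t x. (t, x) \<notin> K \<longrightarrow> \<phi> t x = 0))"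


section \<open>The Sobolev space \<open>H\<^sup>1(\<real>)\<close>\<close>

definition L2 :: "(real \<Rightarrow> 'a::euclidean_space) \<Rightarrow> bool" where
  "L2 f \<longleftrightarrow> f \<in> borel_measurable borel \<and> integrable lborel (\<lambda>x. (norm (f x))\<^sup>2)"

definition has_weak_deriv ::
  "(real \<Rightarrow> 'a::euclidean_space) \<Rightarrow> (real \<Rightarrow> 'a) \<Rightarrow> bool" where
  "has_weak_deriv f g \<longleftrightarrow> (\<forall>\<phi>. test_fun1 \<phi> \<longrightarrow>
     (LINT x|lborel. deriv \<phi> x *\<^sub>R f x) = - (LINT x|lborel. \<phi> x *\<^sub>R g x))"

definition H1 :: "(real \<Rightarrow> 'a::euclidean_space) set" where
  "H1 = {f. L2 f \<and> (\<exists>g. L2 g \<and> has_weak_deriv f g)}"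

text \<open>The weak derivative is unique up to a null set, so the choice does not affect the norm.\<close>

definition weak_deriv :: "(real \<Rightarrow> 'a::euclidean_space) \<Rightarrow> real \<Rightarrow> 'a" where
  "weak_deriv f = (SOME g. L2 g \<and> has_weak_deriv f g)"

definition H1_norm :: "(real \<Rightarrow> 'a::euclidean_space) \<Rightarrow> real" where
  "H1_norm f = sqrt ((LINT x|lborel. (norm (f x))\<^sup>2) + (LINT x|lborel. (norm (weak_deriv f x))\<^sup>2))"

definition continuous_H1 :: "real \<Rightarrow> (real \<Rightarrow> real \<Rightarrow> 'a::euclidean_space) \<Rightarrow> bool" where
  "continuous_H1 T f \<longleftrightarrow> (\<forall>t\<in>{0..T}. f t \<in> H1 \<and>
     ((\<lambda>s. H1_norm (\<lambda>x. f s x - f t x)) \<longlongrightarrow> 0) (at t within {0..T}))"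


section \<open>Bourgain spaces\<close>

definition japanese_bracket :: "real \<Rightarrow> real" where
  "japanese_bracket y = sqrt (1 + \<bar>y\<bar>\<^sup>2)"

definition fourier2 :: "(real \<Rightarrow> real \<Rightarrow> complex) \<Rightarrow> real \<Rightarrow> real \<Rightarrow> complex" where
  "fourier2 f \<xi> \<tau> = (LINT z|lborel. (case z of (t, x) \<Rightarrow> cis (- (x * \<xi> + t * \<tau>)) * f t x))"

definition bourgain_norm ::
  "(real \<Rightarrow> real \<Rightarrow> real) \<Rightarrow> (real \<Rightarrow> real \<Rightarrow> complex) \<Rightarrow> real" where
  "bourgain_norm w f =
     sqrt (LINT z|lborel. (case z of (\<xi>, \<tau>) \<Rightarrow> w \<xi> \<tau> * (cmod (fourier2 f \<xi> \<tau>))\<^sup>2))"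

text \<open>
  The completion of the Schwartz space under \<open>bourgain_norm w\<close>, realised inside
  \<open>L\<^sup>2(\<real>\<^sup>2)\<close>: its elements are the \<open>L\<^sup>2\<close> limits of sequences of Schwartz functions that are
  Cauchy in the norm.  This realisation is faithful when the weight is bounded below by a
  positive constant, in particular for the weights below when \<open>k, s, b \<ge> 0\<close>.
\<close>

definition bourgain_space ::
  "(real \<Rightarrow> real \<Rightarrow> real) \<Rightarrow> (real \<Rightarrow> real \<Rightarrow> complex) set" where
  "bourgain_space w = {f. (\<lambda>(t, x). f t x) \<in> borel_measurable borel \<and>
     (\<exists>F :: nat \<Rightarrow> real \<Rightarrow> real \<Rightarrow> complex.
        (\<forall>n. schwartz2 (F n)) \<and>
        (\<forall>\<epsilon>>0. \<exists>N. \<forall>n\<ge>N. \<forall>m\<ge>N. bourgain_norm w (\<lambda>t x. F n t x - F m t x) < \<epsilon>) \<and>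
        ((\<lambda>n. \<integral>\<^sup>+z. (case z of (t, x) \<Rightarrow> ennreal ((cmod (F n t x - f t x))\<^sup>2)) \<partial>lborel)
           \<longlonglongrightarrow> 0))}"

definition X_space :: "real \<Rightarrow> real \<Rightarrow> (real \<Rightarrow> real \<Rightarrow> complex) set" where
  "X_space k b = bourgain_space
     (\<lambda>\<xi> \<tau>. japanese_bracket \<xi> powr (2 * k) * japanese_bracket (\<tau> + \<xi>\<^sup>2) powr (2 * b))"

definition Y_space :: "real \<Rightarrow> real \<Rightarrow> (real \<Rightarrow> real \<Rightarrow> complex) set" where
  "Y_space s b = bourgain_space
     (\<lambda>\<xi> \<tau>. japanese_bracket \<xi> powr (2 * s) * japanese_bracket (\<tau> - \<xi> ^ 3) powr (2 * b))"


section \<open>Solutions of the Schroedinger--Korteweg--de Vries system\<close>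

text \<open>
  The equations hold in the sense of distributions on \<open>(0,T) \<times> \<real>\<close>, with the nonlinearity
  \<open>v \<partial>\<^sub>x v\<close> read as \<open>\<partial>\<^sub>x (v\<^sup>2 / 2)\<close>.  Iterated integrals are used because a continuous curve in
  \<open>H\<^sup>1\<close> need not have a jointly measurable family of representatives; for such a curve the
  inner integral is a continuous function of \<open>t\<close>.
\<close>

definition schroedinger_eq ::
  "real \<Rightarrow> real \<Rightarrow> real \<Rightarrow> (real \<Rightarrow> real \<Rightarrow> complex) \<Rightarrow> (real \<Rightarrow> real \<Rightarrow> real) \<Rightarrow> bool" where
  "schroedinger_eq \<alpha> \<beta> T u v \<longleftrightarrow> (\<forall>\<phi>. test_fun2 T \<phi> \<longrightarrow>
     (LINT t|lborel. LINT x|lborel.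
        - \<i> * of_real (pd_t \<phi> t x) * u t x + of_real ((pd_x ^^ 2) \<phi> t x) * u t x)
     = (LINT t|lborel. LINT x|lborel. of_real (\<phi> t x) *
          (of_real \<alpha> * u t x * of_real (v t x) + of_real \<beta> * u t x * of_real ((cmod (u t x))\<^sup>2))))"

definition kdv_eq ::
  "real \<Rightarrow> real \<Rightarrow> (real \<Rightarrow> real \<Rightarrow> complex) \<Rightarrow> (real \<Rightarrow> real \<Rightarrow> real) \<Rightarrow> bool" where
  "kdv_eq \<gamma> T u v \<longleftrightarrow> (\<forall>\<phi>. test_fun2 T \<phi> \<longrightarrow>
     (LINT t|lborel. LINT x|lborel.
        - pd_t \<phi> t x * v t x - (pd_x ^^ 3) \<phi> t x * v t x - pd_x \<phi> t x * ((v t x)\<^sup>2 / 2))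
     = (LINT t|lborel. LINT x|lborel. - \<gamma> * pd_x \<phi> t x * (cmod (u t x))\<^sup>2))"

text \<open>
  \<open>u\<close> and \<open>v\<close> are only meaningful for \<open>t \<ge> 0\<close>, so the time cutoff \<open>\<eta>\<close>, which is also nonzero at
  some negative times, multiplies extensions \<open>U\<close> and \<open>V\<close> of them from \<open>[0,T]\<close> to all times.
\<close>

definition bourgain_regular ::
  "real \<Rightarrow> (real \<Rightarrow> real \<Rightarrow> complex) \<Rightarrow> (real \<Rightarrow> real \<Rightarrow> real) \<Rightarrow> bool" where
  "bourgain_regular T u v \<longleftrightarrow> (\<exists>b \<eta> U V. 1 / 2 < b \<and> b < 1 \<and>
     test_fun1 \<eta> \<and> (\<forall>t\<in>{0..T}. \<eta> t = 1) \<and>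
     (\<forall>t\<in>{0..T}. AE x in lborel. U t x = u t x \<and> V t x = v t x) \<and>
     (\<lambda>t x. of_real (\<eta> t) * U t x) \<in> X_space 1 b \<and>
     (\<lambda>t x. of_real (\<eta> t * V t x)) \<in> Y_space 1 b)"

definition nls_kdv_solution_on ::
  "real \<Rightarrow> real \<Rightarrow> real \<Rightarrow> real \<Rightarrow> (real \<Rightarrow> complex) \<Rightarrow> (real \<Rightarrow> real)
    \<Rightarrow> (real \<Rightarrow> real \<Rightarrow> complex) \<Rightarrow> (real \<Rightarrow> real \<Rightarrow> real) \<Rightarrow> bool" where
  "nls_kdv_solution_on \<alpha> \<beta> \<gamma> T u0 v0 u v \<longleftrightarrow>
     continuous_H1 T u \<and> continuous_H1 T v \<and>
     schroedinger_eq \<alpha> \<beta> T u v \<and> kdv_eq \<gamma> T u v \<and>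
     (AE x in lborel. u 0 x = u0 x) \<and> (AE x in lborel. v 0 x = v0 x) \<and>
     bourgain_regular T u v"

text \<open>
  The last clause is the a priori estimate
  \<open>\<parallel>u(t)\<parallel> + \<parallel>v(t)\<parallel> \<le> \<Psi>(\<parallel>u\<^sub>0\<parallel>, \<parallel>v\<^sub>0\<parallel>)\<close> in \<open>H\<^sup>1\<close> which, for \<open>\<alpha>\<gamma> > 0\<close>, comes with the global
  solution of Corcho and Linares; for a single solution the right-hand side is just a constant.
\<close>

definition nls_kdv_global_solution ::
  "real \<Rightarrow> real \<Rightarrow> real \<Rightarrow> (real \<Rightarrow> complex) \<Rightarrow> (real \<Rightarrow> real)
    \<Rightarrow> (real \<Rightarrow> real \<Rightarrow> complex) \<Rightarrow> (real \<Rightarrow> real \<Rightarrow> real) \<Rightarrow> bool" where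
  "nls_kdv_global_solution \<alpha> \<beta> \<gamma> u0 v0 u v \<longleftrightarrow>
     (\<forall>T>0. nls_kdv_solution_on \<alpha> \<beta> \<gamma> T u0 v0 u v) \<and>
     bdd_above ((\<lambda>t. H1_norm (u t) + H1_norm (v t)) ` {0..})"


definition Gamma_region :: "real \<Rightarrow> real \<Rightarrow> real \<Rightarrow> real \<Rightarrow> real set" where
  "Gamma_region C m p t = {x. \<bar>x - t powr m\<bar> \<le> C * t powr p}"

end

theory Submission
  imports Defs "HOL-Computational_Algebra.Polynomial"
begin

text \<open>
  The proof combines the Korteweg--de Vries equation with the boundedness of \<open>u(t)\<close> and \<open>v(t)\<close> in
  \<open>L\<^sup>2\<close>, which follows from the one in \<open>H\<^sup>1\<close>.  The equation is a conservation law for \<open>v\<close> whose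
  flux contains \<open>w = v\<^sup>2/2 - \<gamma>|u|\<^sup>2\<close>, and since
  \<open>\<gamma> < 0\<close> both terms of \<open>w\<close> are nonnegative.  Tested against a product \<open>a(t) b(x)\<close> it says

    \<open>\<integral> a \<integral> b' w = - \<integral> a' \<integral> b v - \<integral> a \<integral> (\<partial>\<^sub>x\<^sup>3 b) v\<close>,

  so a weight \<open>b\<close> that increases on the region of interest turns bounds for integrals linear in \<open>v\<close>
  into a bound for the time average of the mass of \<open>w\<close> there (\<open>kdv_eq_separated\<close>,
  \<open>kdv_virial_inequality\<close>).

  The weight must have compact support, hence must also decrease somewhere.  It is taken as
  \<open>b(x) = B((x - c)/l\<^sub>1) - B((x - c)/l\<^sub>2)\<close> with a smooth step \<open>B\<close>: the slope is about \<open>1/l\<^sub>1\<close> for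
  \<open>|x - c| \<le> l\<^sub>1\<close>, while the descent is spread over the longer scale \<open>l\<^sub>2\<close> and costs only
  \<open>O(1/l\<^sub>2)\<close>.  With a bump \<open>a\<close> of duration \<open>L\<close>, Cauchy--Schwarz then shows that a lower bound
  \<open>\<epsilon>\<close> for the mass of \<open>w\<close> in \<open>[c - l\<^sub>1, c + l\<^sub>1]\<close> throughout a time interval of length \<open>L\<close> obeys

    \<open>\<epsilon> \<le> K (l\<^sub>1 sqrt l\<^sub>2 / L + sqrt l\<^sub>2 / l\<^sub>1\<^sup>2 + l\<^sub>1 / l\<^sub>2)\<close>

  with \<open>K\<close> independent of the window (\<open>kdv_window_estimate\<close>).

  Instead of following the moving centre \<open>t\<^sup>m\<close>, the window stays at \<open>c = R\<^sup>m\<close> during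
  \<open>[R, R + R\<^sup>l]\<close>.  If \<open>l \<le> 1\<close> and \<open>l \<le> p + 1 - m\<close>, the centre moves by at most
  \<open>R\<^sup>m\<^sup>-\<^sup>1 R\<^sup>l \<le> R\<^sup>p\<close>, so \<open>l\<^sub>1 = (2C + 1) R\<^sup>p\<close> covers the region
  (\<open>Gamma_region_subset_window\<close>).  With \<open>l\<^sub>2\<close> of order \<open>R\<^sup>q\<close> the right-hand side tends to \<open>0\<close> as
  \<open>R \<rightarrow> \<infinity>\<close> provided that \<open>p + q/2 < l\<close>, \<open>q < 4p\<close> and \<open>p < q\<close>.  Such \<open>l\<close> and \<open>q\<close> exist exactly
  when \<open>3p/2 < min 1 (p + 1 - m)\<close>, that is, when \<open>p < 2/3\<close> and \<open>m < 1 - p/2\<close>.  Hence the mass of \<open>w\<close>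
  in the region cannot stay above a positive \<open>\<epsilon>\<close> for all large times, and as \<open>w\<close> dominates both
  \<open>v\<^sup>2\<close> and \<open>|u|\<^sup>2\<close> up to constants, both lower limits vanish.
\<close>

section \<open>Closure properties of smooth functions\<close>

text \<open>
  Each iterated derivative of \<open>f\<close> stays in \<open>S\<close>.  Smoothness of products and of the flat
  exponential is obtained from a family that is visibly closed under differentiation, without any
  formula for the higher derivatives.
\<close>

lemma smooth1_coinduct:
  assumes "f \<in> S"
    and closed: "\<And>g. g \<in> S \<Longrightarrow> \<exists>g'\<in>S. \<forall>x. (g has_real_derivative g' x) (at x)"
  shows "smooth1 f"
proof -
  have iter: "(deriv ^^ n) f \<in> S" for n
  proof (induction n)
    case (Suc n)
    then obtain g' where "g' \<in> S" and "\<forall>x. ((deriv ^^ n) f has_real_derivative g' x) (at x)"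
      using closed by blast
    then have "deriv ((deriv ^^ n) f) = g'"
      by (auto intro: DERIV_imp_deriv)
    with \<open>g' \<in> S\<close> show ?case by simp
  qed (use assms in simp)
  show ?thesis
    unfolding smooth1_def
  proof
    fix n
    obtain g' where "\<forall>x. ((deriv ^^ n) f has_real_derivative g' x) (at x)"
      using closed[OF iter] by blast
    then show "(deriv ^^ n) f differentiable_on UNIV"
      by (auto simp: differentiable_on_def real_differentiable_def)
  qed
qed

lemma smooth1_has_deriv:
  assumes "smooth1 f"
  shows "((deriv ^^ n) f has_real_derivative (deriv ^^ Suc n) f x) (at x)"
proof -
  have "(deriv ^^ n) f differentiable at x"
    using assms by (simp add: smooth1_def differentiable_on_def)
  then show ?thesis
    by (simp add: DERIV_deriv_iff_real_differentiable)
qed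

lemma smooth1_deriv: "smooth1 f \<Longrightarrow> smooth1 ((deriv ^^ n) f)"
  unfolding smooth1_def by (metis comp_apply funpow_add)

lemma smooth1_continuous_on: "smooth1 f \<Longrightarrow> continuous_on S ((deriv ^^ n) f)"
  by (meson DERIV_isCont continuous_at_imp_continuous_on smooth1_has_deriv)

lemma smooth1_antiderivative:
  assumes "smooth1 f" and F: "\<And>x. (F has_real_derivative f x) (at x)"
  shows "smooth1 F"
proof (rule smooth1_coinduct[where S = "insert F (range (\<lambda>n. (deriv ^^ n) f))"])
  fix g assume "g \<in> insert F (range (\<lambda>n. (deriv ^^ n) f))"
  then consider "g = F" | n where "g = (deriv ^^ n) f" by blast
  then show "\<exists>g'\<in>insert F (range (\<lambda>n. (deriv ^^ n) f)). \<forall>x. (g has_real_derivative g' x) (at x)"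
  proof cases
    case 1
    have "f = (deriv ^^ 0) f" by simp
    then show ?thesis using F 1 by blast
  next
    case 2
    then show ?thesis using smooth1_has_deriv[OF \<open>smooth1 f\<close>, of n] by blast
  qed
qed simp

lemma affine_has_deriv:
  assumes "smooth1 f"
  shows "((\<lambda>x. (deriv ^^ n) f ((x - c) / l) / l ^ n) has_real_derivative
    (deriv ^^ Suc n) f ((x - c) / l) / l ^ Suc n) (at x)"
proof -
  have "((\<lambda>x. (x - c) / l) has_real_derivative 1 / l) (at x)"
    by (intro DERIV_cdivide) (auto intro!: derivative_eq_intros)
  from DERIV_cdivide[OF DERIV_chain2[OF smooth1_has_deriv[OF assms] this], of n "l ^ n"]
  show ?thesis by simp
qed

lemma iterated_deriv_affine:
  assumes "smooth1 f"
  shows "(deriv ^^ n) (\<lambda>x. f ((x - c) / l)) = (\<lambda>x. (deriv ^^ n) f ((x - c) / l) / l ^ n)"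
proof (induction n)
  case (Suc n)
  have "deriv (\<lambda>x. (deriv ^^ n) f ((x - c) / l) / l ^ n) x = (deriv ^^ Suc n) f ((x - c) / l) / l ^ Suc n" for x
    using affine_has_deriv[OF assms] by (rule DERIV_imp_deriv)
  then show ?case by (simp only: funpow.simps comp_apply Suc)
qed simp

lemma smooth1_affine:
  assumes "smooth1 f"
  shows "smooth1 (\<lambda>x. f ((x - c) / l))"
proof (rule smooth1_coinduct[where S = "{\<lambda>x. (deriv ^^ n) f ((x - c) / l) / l ^ n | n. True}"])
  show "(\<lambda>x. f ((x - c) / l)) \<in> {\<lambda>x. (deriv ^^ n) f ((x - c) / l) / l ^ n | n. True}"
    by (auto intro!: exI[of _ 0])
next
  fix g assume "g \<in> {\<lambda>x. (deriv ^^ n) f ((x - c) / l) / l ^ n | n. True}"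
  then obtain n where g: "g = (\<lambda>x. (deriv ^^ n) f ((x - c) / l) / l ^ n)" by blast
  have "(g has_real_derivative (deriv ^^ Suc n) f ((x - c) / l) / l ^ Suc n) (at x)" for x
    unfolding g by (rule affine_has_deriv[OF assms])
  then show "\<exists>g'\<in>{\<lambda>x. (deriv ^^ n) f ((x - c) / l) / l ^ n | n. True}. \<forall>x. (g has_real_derivative g' x) (at x)"
    by (intro bexI[of _ "\<lambda>x. (deriv ^^ Suc n) f ((x - c) / l) / l ^ Suc n"] allI CollectI
        exI[of _ "Suc n"] conjI refl TrueI)
qed

lemma iterated_deriv_diff:
  assumes "smooth1 f" "smooth1 g"
  shows "(deriv ^^ n) (\<lambda>x. f x - g x) = (\<lambda>x. (deriv ^^ n) f x - (deriv ^^ n) g x)"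
proof (induction n)
  case (Suc n)
  have "deriv (\<lambda>x. (deriv ^^ n) f x - (deriv ^^ n) g x) x = (deriv ^^ Suc n) f x - (deriv ^^ Suc n) g x" for x
    by (rule DERIV_imp_deriv) (intro DERIV_diff smooth1_has_deriv assms)
  then show ?case by (simp only: funpow.simps comp_apply Suc)
qed simp

lemma smooth1_diff:
  assumes "smooth1 f" "smooth1 g"
  shows "smooth1 (\<lambda>x. f x - g x)"
proof -
  have "(\<lambda>x. (deriv ^^ n) f x - (deriv ^^ n) g x) differentiable_on UNIV" for n
    using assms by (auto simp: smooth1_def intro: differentiable_on_diff)
  then show ?thesis
    unfolding smooth1_def iterated_deriv_diff[OF assms] by blast
qed

text \<open>
  The Leibniz rule turns one product into a sum of two, so sums are needed for closure under
  differentiation.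
\<close>

inductive_set product_sums :: "(real \<Rightarrow> real) set" where
  product: "smooth1 f \<Longrightarrow> smooth1 g \<Longrightarrow> (\<lambda>x. f x * g x) \<in> product_sums"
| sum: "f \<in> product_sums \<Longrightarrow> g \<in> product_sums \<Longrightarrow> (\<lambda>x. f x + g x) \<in> product_sums"

lemma smooth1_mult:
  assumes "smooth1 f" "smooth1 g"
  shows "smooth1 (\<lambda>x. f x * g x)"
proof (rule smooth1_coinduct[where S = product_sums])
  show "(\<lambda>x. f x * g x) \<in> product_sums"
    using assms by (rule product_sums.product)
next
  fix h assume "h \<in> product_sums"
  then show "\<exists>h'\<in>product_sums. \<forall>x. (h has_real_derivative h' x) (at x)"
  proof induction
    case (product f g)
    have "(\<lambda>x. (deriv ^^ 1) f x * (deriv ^^ 0) g x + (deriv ^^ 0) f x * (deriv ^^ 1) g x) \<in> product_sums"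
      by (intro product_sums.intros smooth1_deriv product.hyps)
    moreover have "((\<lambda>x. f x * g x) has_real_derivative
        (deriv ^^ 1) f x * (deriv ^^ 0) g x + (deriv ^^ 0) f x * (deriv ^^ 1) g x) (at x)" for x
      using DERIV_mult[OF smooth1_has_deriv[OF product.hyps(1), of 0 x] smooth1_has_deriv[OF product.hyps(2), of 0 x]]
      by (simp add: ac_simps)
    ultimately show ?case by (intro bexI) auto
  next
    case (sum f g)
    then obtain f' g' where "f' \<in> product_sums" "g' \<in> product_sums"
      "\<forall>x. (f has_real_derivative f' x) (at x)" "\<forall>x. (g has_real_derivative g' x) (at x)"
      by blast
    then show ?case
      by (intro bexI[of _ "\<lambda>x. f' x + g' x"]) (auto intro: DERIV_add product_sums.sum)
  qed
qed

section \<open>A smooth bump and a smooth step\<close>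

text \<open>
  Every derivative of \<open>exp (-1/x)\<close> is a polynomial in \<open>1/x\<close> times the same exponential; the
  polynomial is kept as a parameter so that the family is closed under differentiation.
\<close>

definition flat_exp :: "real poly \<Rightarrow> real \<Rightarrow> real" where
  "flat_exp p x = (if x > 0 then poly p (1 / x) * exp (- (1 / x)) else 0)"

lemma poly_times_exp_minus_tendsto_0: "((\<lambda>y::real. poly p y * exp (- y)) \<longlongrightarrow> 0) at_top"
proof -
  have "((\<lambda>y::real. \<Sum>i\<le>degree p. coeff p i * (y ^ i / exp y)) \<longlongrightarrow> (\<Sum>i\<le>degree p. coeff p i * 0)) at_top"
    by (intro tendsto_intros tendsto_power_div_exp_0)
  then show ?thesis
    by (simp add: poly_altdef exp_minus divide_inverse sum_distrib_right mult.assoc)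
qed

text \<open>
  With \<open>y = 1/x\<close> and \<open>dy/dx = -y\<^sup>2\<close>, the derivative of \<open>p(y) exp (-y)\<close> is
  \<open>(p - p')(y) y\<^sup>2 exp (-y)\<close>.  At the origin the difference quotient from the right is
  \<open>y p(y) exp (-y)\<close> with \<open>y \<rightarrow> \<infinity>\<close>, and the exponential wins.
\<close>

lemma flat_exp_has_derivative:
  "(flat_exp p has_real_derivative flat_exp ((p - pderiv p) * [:0, 0, 1:]) x) (at x)"
proof -
  let ?q = "(p - pderiv p) * [:0, 0, 1:]"
  consider "x < 0" | "x = 0" | "x > 0" by linarith
  then show ?thesis
  proof cases
    case 1
    have "((\<lambda>_. 0) has_real_derivative 0) (at x)" by simp
    then have "(flat_exp p has_real_derivative 0) (at x)"
      by (rule has_field_derivative_transform_within_open[of _ _ _ "{..<0}"])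
        (use 1 in \<open>auto simp: flat_exp_def\<close>)
    then show ?thesis using 1 by (simp add: flat_exp_def)
  next
    case 2
    have "((\<lambda>h. poly (p * [:0, 1:]) (1 / h) * exp (- (1 / h))) \<longlongrightarrow> 0) (at_right 0)"
      using filterlim_compose[OF poly_times_exp_minus_tendsto_0[of "p * [:0, 1:]"] filterlim_inverse_at_top_right]
      by (simp add: inverse_eq_divide)
    then have "((\<lambda>h. (flat_exp p (0 + h) - flat_exp p 0) / h) \<longlongrightarrow> 0) (at_right 0)"
      by (rule Lim_transform_eventually)
        (auto simp: eventually_at_filter flat_exp_def)
    moreover have "((\<lambda>h. (flat_exp p (0 + h) - flat_exp p 0) / h) \<longlongrightarrow> 0) (at_left 0)"
      by (rule Lim_transform_eventually[OF tendsto_const])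
        (auto simp: eventually_at_filter flat_exp_def)
    ultimately have "((\<lambda>h. (flat_exp p (0 + h) - flat_exp p 0) / h) \<longlongrightarrow> 0) (at 0)"
      by (simp add: filterlim_split_at)
    then show ?thesis
      using 2 by (simp add: DERIV_def flat_exp_def)
  next
    case 3
    have "((\<lambda>x. poly p (1 / x) * exp (- (1 / x))) has_real_derivative
        poly ?q (1 / x) * exp (- (1 / x))) (at x)"
      using 3
      by (auto intro!: derivative_eq_intros DERIV_chain2[OF poly_DERIV] simp: divide_simps power2_eq_square algebra_simps)
    then have "(flat_exp p has_real_derivative poly ?q (1 / x) * exp (- (1 / x))) (at x)"
      by (rule has_field_derivative_transform_within_open[of _ _ _ "{0<..}"])
        (use 3 in \<open>auto simp: flat_exp_def\<close>)
    then show ?thesis using 3 by (simp add: flat_exp_def)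
  qed
qed

lemma smooth1_flat_exp: "smooth1 (flat_exp p)"
  by (rule smooth1_coinduct[where S = "range flat_exp"]) (use flat_exp_has_derivative in auto)

text \<open>
  Outside \<open>[a, b]\<close> all derivatives vanish, and on the compact interval they are continuous.
\<close>

lemma bounded_derivs_of_smooth_const_outside:
  assumes "smooth1 f" and l: "\<And>x. x \<le> a \<Longrightarrow> f x = p" and r: "\<And>x. x \<ge> b \<Longrightarrow> f x = q"
  obtains K where "K > 0" "\<And>x. \<bar>(deriv ^^ n) f x\<bar> \<le> K"
proof -
  have out: "(deriv ^^ Suc n) f x = 0" if "x < a \<or> x > b" for x n
    using that
  proof (induction n arbitrary: x)
    case (0 x)
    have "((\<lambda>_. f x) has_real_derivative 0) (at x)" by simp
    then have "(f has_real_derivative 0) (at x)"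
      by (rule has_field_derivative_transform_within_open[of _ _ _ "if x < a then {..<a} else {b<..}"])
        (use 0 l r in \<open>auto split: if_splits\<close>)
    then show ?case by (simp add: DERIV_imp_deriv)
  next
    case (Suc n x)
    have "((\<lambda>_. 0) has_real_derivative 0) (at x)" by simp
    then have "((deriv ^^ Suc n) f has_real_derivative 0) (at x)"
      by (rule has_field_derivative_transform_within_open[of _ _ _ "if x < a then {..<a} else {b<..}"])
        (use Suc in \<open>auto split: if_splits\<close>)
    then show ?case by (simp add: DERIV_imp_deriv)
  qed
  have "compact ((deriv ^^ n) f ` {a..b})"
    by (intro compact_continuous_image smooth1_continuous_on assms) simp
  then obtain M where M: "\<And>x. x \<in> {a..b} \<Longrightarrow> \<bar>(deriv ^^ n) f x\<bar> \<le> M"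
    by (force dest!: compact_imp_bounded simp: bounded_iff)
  have "\<bar>(deriv ^^ n) f x\<bar> \<le> \<bar>M\<bar> + \<bar>p\<bar> + \<bar>q\<bar> + 1" for x
  proof (cases "x \<in> {a..b}")
    case True
    then show ?thesis using M[of x] by linarith
  next
    case False
    then show ?thesis
      using out[of x] l[of x] r[of x] by (cases n) auto
  qed
  then show ?thesis
    by (intro that[of "\<bar>M\<bar> + \<bar>p\<bar> + \<bar>q\<bar> + 1"]) auto
qed

lemma smooth_bump_exists:
  obtains \<kappa> :: "real \<Rightarrow> real" where "smooth1 \<kappa>" "\<And>x. \<kappa> x \<ge> 0" "\<And>x. \<bar>x\<bar> \<le> 1 \<Longrightarrow> \<kappa> x \<ge> 1"
    "\<And>x. \<bar>x\<bar> \<ge> 2 \<Longrightarrow> \<kappa> x = 0"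
proof -
  \<comment> \<open>The constant polynomial \<open>exp 1\<close> makes each factor at least \<open>1\<close> where its argument is at least \<open>1\<close>.\<close>
  define \<kappa> where "\<kappa> = (\<lambda>x. flat_exp [:exp 1:] ((x - (-2)) / 1) * flat_exp [:exp 1:] ((x - 2) / (-1)))"
  have smooth: "smooth1 \<kappa>"
    unfolding \<kappa>_def by (intro smooth1_mult smooth1_affine smooth1_flat_exp)
  have nonneg: "\<kappa> x \<ge> 0" for x by (simp add: \<kappa>_def flat_exp_def)
  have ge_1: "flat_exp [:exp 1:] y \<ge> 1" if "y \<ge> 1" for y
    using that by (simp add: flat_exp_def flip: exp_add)
  have plateau: "\<kappa> x \<ge> 1" if "\<bar>x\<bar> \<le> 1" for x
    using mult_mono[OF ge_1[of "x + 2"] ge_1[of "2 - x"]] ge_1[of "x + 2"] that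
    by (simp add: \<kappa>_def abs_le_iff)
  have support: "\<kappa> x = 0" if "\<bar>x\<bar> \<ge> 2" for x
    using that by (auto simp: \<kappa>_def flat_exp_def)
  show ?thesis by (rule that[OF smooth nonneg plateau support])
qed

lemma smooth_step_exists:
  obtains B :: "real \<Rightarrow> real" where "smooth1 B" "\<And>x. deriv B x \<ge> 0" "\<And>x. \<bar>x\<bar> \<le> 1 \<Longrightarrow> deriv B x \<ge> 1"
    "\<And>x. \<bar>x\<bar> \<ge> 2 \<Longrightarrow> deriv B x = 0" "\<And>x. x \<le> -2 \<Longrightarrow> B x = B (-2)" "\<And>x. x \<ge> 2 \<Longrightarrow> B x = B 2"
proof -
  obtain \<kappa> :: "real \<Rightarrow> real" where \<kappa>: "smooth1 \<kappa>" "\<And>x. \<kappa> x \<ge> 0" "\<And>x. \<bar>x\<bar> \<le> 1 \<Longrightarrow> \<kappa> x \<ge> 1"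
    "\<And>x. \<bar>x\<bar> \<ge> 2 \<Longrightarrow> \<kappa> x = 0"
    using smooth_bump_exists by metis
  have "isCont \<kappa> x" for x
    using smooth1_has_deriv[OF \<kappa>(1), of 0] by (auto intro: DERIV_isCont)
  then obtain B where B: "\<And>x. (B has_real_derivative \<kappa> x) (at x)"
    using einterval_antiderivative[of "-\<infinity>" \<infinity> \<kappa>] by (auto simp: has_real_derivative_iff_has_vector_derivative)
  have const: "B x = B y" if "x < y" "\<And>z. x < z \<Longrightarrow> z < y \<Longrightarrow> \<bar>z\<bar> \<ge> 2" for x y
  proof (rule DERIV_isconst_end[of x y B, symmetric])
    show "continuous_on {x..y} B"
      using B by (meson DERIV_isCont continuous_at_imp_continuous_on)
    show "(B has_real_derivative 0) (at z)" if "x < z" "z < y" for z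
      using B[of z] \<kappa>(4)[of z] \<open>\<And>z. x < z \<Longrightarrow> z < y \<Longrightarrow> \<bar>z\<bar> \<ge> 2\<close>[OF that] by simp
  qed (rule that)
  have [simp]: "deriv B = \<kappa>" using B by (auto intro: DERIV_imp_deriv)
  have smooth: "smooth1 B" using \<kappa>(1) B by (rule smooth1_antiderivative)
  have left: "B x = B (-2)" if "x \<le> -2" for x
    using const[of x "-2"] that by (cases "x = -2") auto
  have right: "B x = B 2" if "x \<ge> 2" for x
    using const[of 2 x] that by (cases "x = 2") auto
  show ?thesis by (rule that[OF smooth _ _ _ left right]) (simp_all add: \<kappa>)
qed

section \<open>Square-integrable functions\<close>

definition l2_norm :: "(real \<Rightarrow> 'a::euclidean_space) \<Rightarrow> real" where
  "l2_norm f = sqrt (LINT x|lborel. (norm (f x))\<^sup>2)"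

lemma l2_norm_nonneg [simp]: "l2_norm f \<ge> 0"
  by (simp add: l2_norm_def)

lemma l2_norm_power2: "(l2_norm f)\<^sup>2 = (LINT x|lborel. (norm (f x))\<^sup>2)"
  by (simp add: l2_norm_def)

lemma L2_diff:
  assumes "L2 f" "L2 g"
  shows "L2 (\<lambda>x. f x - g x)"
  unfolding L2_def
proof
  have [measurable]: "f \<in> borel_measurable borel" "g \<in> borel_measurable borel"
    using assms by (auto simp: L2_def)
  show "(\<lambda>x. f x - g x) \<in> borel_measurable borel" by measurable
  have bound: "(norm (f x - g x))\<^sup>2 \<le> 2 * (norm (f x))\<^sup>2 + 2 * (norm (g x))\<^sup>2" for x
  proof -
    have "(norm (f x - g x))\<^sup>2 \<le> (norm (f x) + norm (g x))\<^sup>2"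
      by (intro power_mono norm_triangle_ineq4) simp
    also have "\<dots> \<le> 2 * (norm (f x))\<^sup>2 + 2 * (norm (g x))\<^sup>2"
      using zero_le_power2[of "norm (f x) - norm (g x)"] by (simp add: power2_eq_square algebra_simps)
    finally show ?thesis .
  qed
  show "integrable lborel (\<lambda>x. (norm (f x - g x))\<^sup>2)"
    by (rule Bochner_Integration.integrable_bound[of _ "\<lambda>x. 2 * (norm (f x))\<^sup>2 + 2 * (norm (g x))\<^sup>2"])
      (use assms bound in \<open>auto simp: L2_def\<close>)
qed

lemma L2_norm: "L2 f \<Longrightarrow> L2 (\<lambda>x. norm (f x))"
  by (auto simp: L2_def)

lemma l2_norm_norm [simp]: "l2_norm (\<lambda>x. norm (f x)) = l2_norm f"
  by (simp add: l2_norm_def)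

lemma L2_mult_integrable:
  fixes f g :: "real \<Rightarrow> real"
  assumes "L2 f" "L2 g"
  shows "integrable lborel (\<lambda>x. f x * g x)"
proof (rule Bochner_Integration.integrable_bound[of _ "\<lambda>x. (norm (f x))\<^sup>2 + (norm (g x))\<^sup>2"])
  show "integrable lborel (\<lambda>x. (norm (f x))\<^sup>2 + (norm (g x))\<^sup>2)"
    using assms by (auto simp: L2_def)
  show "(\<lambda>x. f x * g x) \<in> borel_measurable lborel"
    using assms by (auto simp: L2_def)
  have "\<bar>a * b\<bar> \<le> a\<^sup>2 + b\<^sup>2" for a b :: real
  proof -
    have "2 * (\<bar>a\<bar> * \<bar>b\<bar>) \<le> a\<^sup>2 + b\<^sup>2"
      using zero_le_power2[of "\<bar>a\<bar> - \<bar>b\<bar>"] by (simp add: power2_eq_square algebra_simps)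
    moreover have "0 \<le> \<bar>a\<bar> * \<bar>b\<bar>" by simp
    ultimately show ?thesis unfolding abs_mult by linarith
  qed
  then show "AE x in lborel. norm (f x * g x) \<le> norm ((norm (f x))\<^sup>2 + (norm (g x))\<^sup>2)"
    by auto
qed

lemma L2_Cauchy_Schwarz:
  fixes f g :: "real \<Rightarrow> real"
  assumes "L2 f" "L2 g"
  shows "\<bar>LINT x|lborel. f x * g x\<bar> \<le> l2_norm f * l2_norm g"
proof -
  define P where "P = (LINT x|lborel. f x * g x)"
  define F where "F = (LINT x|lborel. (f x)\<^sup>2)"
  define G where "G = (LINT x|lborel. (g x)\<^sup>2)"
  have quad: "0 \<le> F - 2 * r * P + r\<^sup>2 * G" for r
  proof -
    have "0 \<le> (LINT x|lborel. (f x - r * g x)\<^sup>2)" by simp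
    also have "\<dots> = (LINT x|lborel. (f x)\<^sup>2 - 2 * r * (f x * g x) + r\<^sup>2 * (g x)\<^sup>2)"
      by (simp add: power2_eq_square algebra_simps)
    also have "\<dots> = F - 2 * r * P + r\<^sup>2 * G"
      unfolding F_def P_def G_def using assms L2_mult_integrable[OF assms] by (simp add: L2_def)
    finally show ?thesis .
  qed
  have "G \<ge> 0" by (simp add: G_def)
  have "P\<^sup>2 \<le> F * G"
  proof (cases "G = 0")
    case True
    have "P = 0"
    proof (rule ccontr)
      assume "P \<noteq> 0"
      then show False
        \<comment> \<open>This \<open>r\<close> makes the affine function \<open>F - 2 r P\<close> equal to \<open>-1\<close>.\<close>
        using quad[of "(F + 1) / (2 * P)"] True by simp
    qed
    then show ?thesis using True by simp
  next
    case False
    then show ?thesis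
      \<comment> \<open>The minimiser of the quadratic polynomial.\<close>
      using quad[of "P / G"] \<open>G \<ge> 0\<close> by (simp add: divide_simps power2_eq_square mult.commute)
  qed
  then have "\<bar>P\<bar> \<le> sqrt (F * G)"
    by (metis real_sqrt_abs real_sqrt_le_iff)
  then show ?thesis
    by (simp add: P_def F_def G_def l2_norm_def real_sqrt_mult)
qed

lemma integrable_bounded_mult_power2:
  assumes "L2 f" and [measurable]: "b \<in> borel_measurable borel" and "\<And>x. \<bar>b x\<bar> \<le> K"
  shows "integrable lborel (\<lambda>x. b x * (norm (f x))\<^sup>2)"
proof (rule Bochner_Integration.integrable_bound[of _ "\<lambda>x. K * (norm (f x))\<^sup>2"])
  have [measurable]: "f \<in> borel_measurable borel" using assms by (simp add: L2_def)
  show "(\<lambda>x. b x * (norm (f x))\<^sup>2) \<in> borel_measurable lborel" by measurable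
  show "AE x in lborel. norm (b x * (norm (f x))\<^sup>2) \<le> norm (K * (norm (f x))\<^sup>2)"
    using assms(3) by (auto simp: abs_mult intro!: mult_right_mono order_trans[OF _ abs_ge_self])
qed (use assms in \<open>simp add: L2_def\<close>)

text \<open>
  The bound grows only like the square root of the width of the support; for the
  two-scale weight this is the factor \<open>sqrt l\<^sub>2\<close> in its \<open>L\<^sup>2\<close> norms.
\<close>

lemma L2_bounded_support:
  fixes b :: "real \<Rightarrow> real"
  assumes [measurable]: "b \<in> borel_measurable borel" and K: "\<And>x. \<bar>b x\<bar> \<le> K"
    and supp: "\<And>x. \<bar>x - c\<bar> > r \<Longrightarrow> b x = 0" and "r \<ge> 0"
  shows "L2 b" and "l2_norm b \<le> K * sqrt (2 * r)"
proof -
  have "K \<ge> 0" using K[of 0] by linarith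
  have le: "(b x)\<^sup>2 \<le> K\<^sup>2 * indicator {c - r..c + r} x" for x
    using power_mono[OF K[of x], of 2] supp[of x] by (auto simp: indicator_def abs_le_iff)
  have int: "integrable lborel (\<lambda>x. K\<^sup>2 * indicator {c - r..c + r} x)"
    by (intro integrable_mult_right integrable_real_indicator) (auto simp: emeasure_lborel_Icc_eq)
  have b2: "integrable lborel (\<lambda>x. (b x)\<^sup>2)"
    by (rule Bochner_Integration.integrable_bound[OF int]) (use le in auto)
  then show "L2 b" by (simp add: L2_def)
  have "(LINT x|lborel. (b x)\<^sup>2) \<le> (LINT x|lborel. K\<^sup>2 * indicator {c - r..c + r} x)"
    by (rule integral_mono[OF b2 int]) (rule le)
  also have "\<dots> = K\<^sup>2 * (2 * r)"
    using \<open>r \<ge> 0\<close> by simp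
  finally have "l2_norm b \<le> sqrt (K\<^sup>2 * (2 * r))"
    by (simp add: l2_norm_def)
  then show "l2_norm b \<le> K * sqrt (2 * r)"
    using \<open>K \<ge> 0\<close> by (simp add: real_sqrt_mult)
qed

lemma l2_norm_le_H1_norm: "l2_norm f \<le> H1_norm f"
  by (simp add: l2_norm_def H1_norm_def)

lemma continuous_H1_L2: "continuous_H1 T f \<Longrightarrow> t \<in> {0..T} \<Longrightarrow> L2 (f t)"
  by (simp add: continuous_H1_def H1_def)

lemma continuous_H1_l2_tendsto:
  assumes "continuous_H1 T f" "t \<in> {0..T}"
  shows "((\<lambda>s. l2_norm (\<lambda>x. f s x - f t x)) \<longlongrightarrow> 0) (at t within {0..T})"
proof (rule tendsto_sandwich[OF always_eventually always_eventually tendsto_const])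
  show "((\<lambda>s. H1_norm (\<lambda>x. f s x - f t x)) \<longlongrightarrow> 0) (at t within {0..T})"
    using assms by (simp add: continuous_H1_def)
qed (simp_all add: l2_norm_le_H1_norm)

text \<open>
  The Bochner integral of a non-integrable function is \<open>0\<close>, so the iterated integrals in the weak
  form of the equation can be rearranged only once the inner ones are known to be continuous in
  time.  This lemma provides that for the terms linear in the solution,
  \<open>continuous_on_weighted_mass\<close> below for the quadratic ones.
\<close>

lemma continuous_on_L2_pairing:
  fixes f :: "real \<Rightarrow> real \<Rightarrow> real"
  assumes f: "continuous_H1 T f" and "L2 b"
  shows "continuous_on {0..T} (\<lambda>t. LINT x|lborel. b x * f t x)"
  unfolding continuous_on
proof
  fix t assume t: "t \<in> {0..T}"
  have "((\<lambda>s. l2_norm b * l2_norm (\<lambda>x. f s x - f t x)) \<longlongrightarrow> l2_norm b * 0) (at t within {0..T})"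
    by (intro tendsto_intros continuous_H1_l2_tendsto f t)
  then have lim: "((\<lambda>s. l2_norm b * l2_norm (\<lambda>x. f s x - f t x)) \<longlongrightarrow> 0) (at t within {0..T})"
    by simp
  have bound: "\<forall>\<^sub>F s in at t within {0..T}.
      norm ((LINT x|lborel. b x * f s x) - (LINT x|lborel. b x * f t x))
        \<le> l2_norm b * l2_norm (\<lambda>x. f s x - f t x)"
    unfolding eventually_at_filter
  proof (intro always_eventually allI impI)
    fix s assume s: "s \<in> {0..T}"
    have "(LINT x|lborel. b x * f s x) - (LINT x|lborel. b x * f t x)
        = (LINT x|lborel. b x * (f s x - f t x))"
      using L2_mult_integrable[OF \<open>L2 b\<close> continuous_H1_L2[OF f s]]
        L2_mult_integrable[OF \<open>L2 b\<close> continuous_H1_L2[OF f t]]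
      by (simp add: right_diff_distrib)
    then show "norm ((LINT x|lborel. b x * f s x) - (LINT x|lborel. b x * f t x))
        \<le> l2_norm b * l2_norm (\<lambda>x. f s x - f t x)"
      using L2_Cauchy_Schwarz[OF \<open>L2 b\<close> L2_diff[OF continuous_H1_L2[OF f s] continuous_H1_L2[OF f t]]]
      by simp
  qed
  have "((\<lambda>s. (LINT x|lborel. b x * f s x) - (LINT x|lborel. b x * f t x)) \<longlongrightarrow> 0) (at t within {0..T})"
    by (rule Lim_null_comparison[OF bound lim])
  then show "((\<lambda>t. LINT x|lborel. b x * f t x) \<longlongrightarrow> (LINT x|lborel. b x * f t x)) (at t within {0..T})"
    by (rule LIM_zero_cancel)
qed

lemma abs_power2_norm_diff_le:
  fixes a b :: "'a::real_normed_vector"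
  shows "\<bar>(norm a)\<^sup>2 - (norm b)\<^sup>2\<bar> \<le> (norm (a - b))\<^sup>2 + 2 * (norm (a - b) * norm b)"
proof -
  have "\<bar>(norm a)\<^sup>2 - (norm b)\<^sup>2\<bar> = \<bar>norm a - norm b\<bar> * (norm a + norm b)"
    by (simp add: power2_eq_square square_diff_square_factored abs_mult mult.commute)
  also have "\<dots> \<le> norm (a - b) * (norm (a - b) + 2 * norm b)"
    using norm_triangle_ineq3[of a b] norm_triangle_ineq2[of a b]
    by (intro mult_mono) auto
  finally show ?thesis by (simp add: power2_eq_square algebra_simps)
qed

lemma continuous_on_weighted_mass:
  fixes f :: "real \<Rightarrow> real \<Rightarrow> 'a::euclidean_space"
  assumes f: "continuous_H1 T f" and b [measurable]: "b \<in> borel_measurable borel" and K: "\<And>x. \<bar>b x\<bar> \<le> K"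
  shows "continuous_on {0..T} (\<lambda>t. LINT x|lborel. b x * (norm (f t x))\<^sup>2)"
  unfolding continuous_on
proof
  fix t assume t: "t \<in> {0..T}"
  define I where "I = (\<lambda>s. LINT x|lborel. b x * (norm (f s x))\<^sup>2)"
  define d where "d = (\<lambda>s. l2_norm (\<lambda>x. f s x - f t x))"
  have "(d \<longlongrightarrow> 0) (at t within {0..T})"
    unfolding d_def by (intro continuous_H1_l2_tendsto f t)
  then have "((\<lambda>s. K * ((d s)\<^sup>2 + 2 * (d s * l2_norm (f t)))) \<longlongrightarrow> K * (0\<^sup>2 + 2 * (0 * l2_norm (f t)))) (at t within {0..T})"
    by (intro tendsto_intros)
  then have lim: "((\<lambda>s. K * ((d s)\<^sup>2 + 2 * (d s * l2_norm (f t)))) \<longlongrightarrow> 0) (at t within {0..T})"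
    by simp
  have bound: "\<forall>\<^sub>F s in at t within {0..T}. norm (I s - I t) \<le> K * ((d s)\<^sup>2 + 2 * (d s * l2_norm (f t)))"
    unfolding eventually_at_filter
  proof (intro always_eventually allI impI)
    fix s assume s: "s \<in> {0..T}"
    note fs = continuous_H1_L2[OF f s] and ft = continuous_H1_L2[OF f t]
    note diff = L2_diff[OF fs ft]
    have "K \<ge> 0" using K[of 0] by linarith
    have int2: "integrable lborel (\<lambda>x. norm (f s x - f t x) * norm (f t x))"
      by (rule L2_mult_integrable) (intro L2_norm diff ft)+
    have int: "integrable lborel (\<lambda>x. K * ((norm (f s x - f t x))\<^sup>2 + 2 * (norm (f s x - f t x) * norm (f t x))))"
      using diff int2 by (auto simp: L2_def)
    have "I s - I t = (LINT x|lborel. b x * ((norm (f s x))\<^sup>2 - (norm (f t x))\<^sup>2))"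
      using integrable_bounded_mult_power2[OF fs b K] integrable_bounded_mult_power2[OF ft b K]
      by (simp add: I_def right_diff_distrib)
    also have "norm \<dots> \<le> (LINT x|lborel. K * ((norm (f s x - f t x))\<^sup>2 + 2 * (norm (f s x - f t x) * norm (f t x))))"
    proof (rule Bochner_Integration.integral_norm_bound_integral[OF _ int])
      show "integrable lborel (\<lambda>x. b x * ((norm (f s x))\<^sup>2 - (norm (f t x))\<^sup>2))"
        using integrable_bounded_mult_power2[OF fs b K] integrable_bounded_mult_power2[OF ft b K]
        by (simp add: right_diff_distrib)
      show "norm (b x * ((norm (f s x))\<^sup>2 - (norm (f t x))\<^sup>2))
          \<le> K * ((norm (f s x - f t x))\<^sup>2 + 2 * (norm (f s x - f t x) * norm (f t x)))" for x
        unfolding real_norm_def abs_mult by (intro mult_mono K abs_power2_norm_diff_le \<open>K \<ge> 0\<close>) simp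
    qed
    also have "\<dots> = K * ((d s)\<^sup>2 + 2 * (LINT x|lborel. norm (f s x - f t x) * norm (f t x)))"
      using diff int2 by (simp add: L2_def d_def l2_norm_power2)
    also have "\<dots> \<le> K * ((d s)\<^sup>2 + 2 * (d s * l2_norm (f t)))"
      using L2_Cauchy_Schwarz[OF L2_norm[OF diff] L2_norm[OF ft]]
      by (intro mult_left_mono add_left_mono) (auto simp: d_def \<open>K \<ge> 0\<close>)
    finally show "norm (I s - I t) \<le> K * ((d s)\<^sup>2 + 2 * (d s * l2_norm (f t)))" .
  qed
  have "((\<lambda>s. I s - I t) \<longlongrightarrow> 0) (at t within {0..T})"
    by (rule Lim_null_comparison[OF bound lim])
  then show "((\<lambda>t. LINT x|lborel. b x * (norm (f t x))\<^sup>2) \<longlongrightarrow> (LINT x|lborel. b x * (norm (f t x))\<^sup>2)) (at t within {0..T})"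
    unfolding I_def by (rule LIM_zero_cancel)
qed

section \<open>The Korteweg--de Vries equation tested against products\<close>

lemma iterated_pd_x_product:
  assumes "smooth1 b"
  shows "(pd_x ^^ k) (\<lambda>t x. a t * b x) = (\<lambda>t x. a t * (deriv ^^ k) b x)"
proof (induction k)
  case (Suc k)
  have "pd_x (\<lambda>t x. a t * (deriv ^^ k) b x) t x = a t * (deriv ^^ Suc k) b x" for t x
    unfolding pd_x_def
    by (intro vector_derivative_at DERIV_cmult[THEN has_real_derivative_iff_has_vector_derivative[THEN iffD1]]
        smooth1_has_deriv assms)
  then have "pd_x (\<lambda>t x. a t * (deriv ^^ k) b x) = (\<lambda>t x. a t * (deriv ^^ Suc k) b x)"
    by blast
  then show ?case by (simp only: funpow.simps comp_apply Suc)
qed simp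

lemma iterated_pd_t_product:
  assumes "smooth1 a"
  shows "(pd_t ^^ j) (\<lambda>t x. a t * c x) = (\<lambda>t x. (deriv ^^ j) a t * c x)"
proof (induction j)
  case (Suc j)
  have "pd_t (\<lambda>t x. (deriv ^^ j) a t * c x) t x = (deriv ^^ Suc j) a t * c x" for t x
    unfolding pd_t_def
    by (intro vector_derivative_at DERIV_cmult_right[THEN has_real_derivative_iff_has_vector_derivative[THEN iffD1]]
        smooth1_has_deriv assms)
  then have "pd_t (\<lambda>t x. (deriv ^^ j) a t * c x) = (\<lambda>t x. (deriv ^^ Suc j) a t * c x)"
    by blast
  then show ?case by (simp only: funpow.simps comp_apply Suc)
qed simp

lemma test_fun2_product:
  assumes "smooth1 a" "test_fun1 b" and a: "\<And>t. t \<notin> {s..r} \<Longrightarrow> a t = 0" and "0 < s" "r < T"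
  shows "test_fun2 T (\<lambda>t x. a t * b x)"
proof -
  have b: "smooth1 b" using assms by (simp add: test_fun1_def)
  have D: "(pd_t ^^ j) ((pd_x ^^ k) (\<lambda>t x. a t * b x)) = (\<lambda>t x. (deriv ^^ j) a t * (deriv ^^ k) b x)" for j k
    by (simp add: iterated_pd_x_product[OF b] iterated_pd_t_product[OF \<open>smooth1 a\<close>])
  have "smooth2 (\<lambda>t x. a t * b x)"
    unfolding smooth2_def D Let_def
  proof (intro allI conjI)
    fix j k t x
    show "continuous_on UNIV (\<lambda>(t, x). (deriv ^^ j) a t * (deriv ^^ k) b x)"
      unfolding case_prod_unfold
      by (intro continuous_intros continuous_on_compose2[OF smooth1_continuous_on[of _ UNIV]] assms b) auto
    show "(\<lambda>s. (deriv ^^ j) a s * (deriv ^^ k) b x) differentiable at t"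
      using DERIV_cmult_right[OF smooth1_has_deriv[OF \<open>smooth1 a\<close>]] real_differentiable_def by blast
    show "(\<lambda>y. (deriv ^^ j) a t * (deriv ^^ k) b y) differentiable at x"
      using DERIV_cmult[OF smooth1_has_deriv[OF b]] real_differentiable_def by blast
  qed
  moreover obtain M where M: "\<And>x. b x \<noteq> 0 \<Longrightarrow> \<bar>x\<bar> \<le> M"
    using assms by (auto simp: test_fun1_def bounded_iff)
  have "a t * b x = 0" if "(t, x) \<notin> {s..r} \<times> {-M..M}" for t x
    using that a[of t] M[of x] by fastforce
  moreover have "compact ({s..r} \<times> {-M..M})" "{s..r} \<times> {-M..M} \<subseteq> {0<..<T} \<times> UNIV"
    using assms by (auto intro: compact_Times)
  ultimately show ?thesis
    unfolding test_fun2_def by blast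
qed

lemma deriv_eq_0_outside:
  assumes "\<And>t. t \<notin> {s..r} \<Longrightarrow> a t = 0" and "t \<notin> {s..r}"
  shows "deriv a t = (0::real)"
proof -
  have "((\<lambda>_. 0) has_real_derivative 0) (at t)" by simp
  then have "(a has_real_derivative 0) (at t)"
    by (rule has_field_derivative_transform_within_open[of _ _ _ "- {s..r}"]) (use assms in auto)
  then show ?thesis by (rule DERIV_imp_deriv)
qed

lemma integrable_continuous_supported:
  fixes h :: "real \<Rightarrow> real"
  assumes "continuous_on {s..r} h" and "\<And>t. t \<notin> {s..r} \<Longrightarrow> h t = 0"
  shows "integrable lborel h"
proof -
  have "set_integrable lborel {s..r} h"
    using assms(1) by (rule borel_integrable_atLeastAtMost')
  moreover have "(\<lambda>t. indicator {s..r} t *\<^sub>R h t) = h"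
    using assms(2) by (fastforce simp: indicator_def)
  ultimately show ?thesis
    by (simp add: set_integrable_def)
qed

text \<open>
  The weak form of the equation, with all terms moved to one side and collected under a single time
  integral.  Integrability is part of the conclusion because the next lemma compares the integrand
  with another one by monotonicity.
\<close>

lemma kdv_eq_separated:
  fixes u :: "real \<Rightarrow> real \<Rightarrow> complex"
  assumes kdv: "kdv_eq \<gamma> T u v" and u: "continuous_H1 T u" and v: "continuous_H1 T v"
    and a: "smooth1 a" and b: "test_fun1 b"
    and supp: "\<And>t. t \<notin> {s..r} \<Longrightarrow> a t = 0" and "0 < s" "r < T"
  defines "h \<equiv> \<lambda>t. deriv a t * (LINT x|lborel. b x * v t x)
      + a t * (LINT x|lborel. (deriv ^^ 3) b x * v t x)
      + a t * (LINT x|lborel. deriv b x * ((v t x)\<^sup>2 / 2 - \<gamma> * (cmod (u t x))\<^sup>2))"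
  shows "integrable lborel h" and "(LINT t|lborel. h t) = 0"
proof -
  have b_smooth: "smooth1 b" using b by (simp add: test_fun1_def)
  obtain M where M: "M \<ge> 0" "\<And>x. \<bar>x\<bar> > M \<Longrightarrow> b x = 0"
  proof -
    obtain M where "\<And>x. b x \<noteq> 0 \<Longrightarrow> \<bar>x\<bar> \<le> M"
      using b by (auto simp: test_fun1_def bounded_iff)
    then show thesis by (intro that[of "max 0 M"]) force+
  qed
  have db_supp: "(deriv ^^ n) b x = 0" if "\<bar>x\<bar> > M" for n x
    using that
  proof (induction n arbitrary: x)
    case (Suc n)
    then show ?case
      using deriv_eq_0_outside[of "-M" M "(deriv ^^ n) b" x] by force
  qed (use M in simp)
  have db_cont: "continuous_on UNIV ((deriv ^^ n) b)" for n
    by (rule smooth1_continuous_on[OF b_smooth])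
  have db_meas [measurable]: "(deriv ^^ n) b \<in> borel_measurable borel" for n
    by (intro borel_measurable_continuous_onI db_cont)
  have db_L2: "L2 ((deriv ^^ n) b)" and db_bdd: "\<exists>K. \<forall>x. \<bar>(deriv ^^ n) b x\<bar> \<le> K" for n
  proof -
    obtain K where "K > 0" and K: "\<And>x. \<bar>(deriv ^^ n) b x\<bar> \<le> K"
      using bounded_derivs_of_smooth_const_outside[OF b_smooth, of "- M - 1" 0 "M + 1" 0 n] M(2)
      by (smt (verit, ccfv_threshold))
    then show "\<exists>K. \<forall>x. \<bar>(deriv ^^ n) b x\<bar> \<le> K" by blast
    show "L2 ((deriv ^^ n) b)"
      by (rule L2_bounded_support[where K = K and c = 0 and r = M]) (use K db_supp M(1) in auto)
  qed
  obtain K1 where K1: "\<And>x. \<bar>deriv b x\<bar> \<le> K1" using db_bdd[of 1] by auto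
  have meas1: "deriv b \<in> borel_measurable borel" using db_meas[of 1] by simp
  have da_supp: "deriv a t = 0" if "t \<notin> {s..r}" for t
    using deriv_eq_0_outside[of s r a t] supp that by blast
  define \<phi> where "\<phi> = (\<lambda>t x. a t * b x)"
  have "test_fun2 T \<phi>"
    unfolding \<phi>_def by (rule test_fun2_product[OF a b supp \<open>0 < s\<close> \<open>r < T\<close>])
  have pdt: "pd_t \<phi> = (\<lambda>t x. deriv a t * b x)"
    using iterated_pd_t_product[OF a, of 1 b] by (simp add: \<phi>_def)
  have pdx: "pd_x \<phi> = (\<lambda>t x. a t * deriv b x)"
    using iterated_pd_x_product[OF b_smooth, of 1 a] by (simp add: \<phi>_def)
  have pdx3: "(pd_x ^^ 3) \<phi> = (\<lambda>t x. a t * (deriv ^^ 3) b x)"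
    unfolding \<phi>_def by (rule iterated_pd_x_product[OF b_smooth])
  define P where "P = (\<lambda>t. LINT x|lborel. b x * v t x)"
  define Q where "Q = (\<lambda>t. LINT x|lborel. (deriv ^^ 3) b x * v t x)"
  define V where "V = (\<lambda>t. LINT x|lborel. deriv b x * (norm (v t x))\<^sup>2)"
  define U where "U = (\<lambda>t. LINT x|lborel. deriv b x * (norm (u t x))\<^sup>2)"
  define g1 where "g1 = (\<lambda>t. deriv a t * P t + a t * Q t + a t * V t / 2)"
  define g2 where "g2 = (\<lambda>t. \<gamma> * a t * U t)"
  have int_P: "integrable lborel (\<lambda>x. b x * v t x)"
    and int_Q: "integrable lborel (\<lambda>x. (deriv ^^ 3) b x * v t x)"
    and int_V: "integrable lborel (\<lambda>x. deriv b x * (norm (v t x))\<^sup>2)"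
    and int_U: "integrable lborel (\<lambda>x. deriv b x * (norm (u t x))\<^sup>2)"
    if "t \<in> {s..r}" for t
  proof -
    have t: "t \<in> {0..T}" using that \<open>0 < s\<close> \<open>r < T\<close> by auto
    show "integrable lborel (\<lambda>x. b x * v t x)"
      using L2_mult_integrable[OF db_L2[of 0] continuous_H1_L2[OF v t]] by simp
    show "integrable lborel (\<lambda>x. (deriv ^^ 3) b x * v t x)"
      by (intro L2_mult_integrable db_L2 continuous_H1_L2[OF v t])
    show "integrable lborel (\<lambda>x. deriv b x * (norm (v t x))\<^sup>2)"
      by (rule integrable_bounded_mult_power2[OF continuous_H1_L2[OF v t] meas1 K1])
    show "integrable lborel (\<lambda>x. deriv b x * (norm (u t x))\<^sup>2)"
      by (rule integrable_bounded_mult_power2[OF continuous_H1_L2[OF u t] meas1 K1])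
  qed
  have cont: "continuous_on {s..r} P" "continuous_on {s..r} Q" "continuous_on {s..r} V" "continuous_on {s..r} U"
  proof -
    have sub: "{s..r} \<subseteq> {0..T}" using \<open>0 < s\<close> \<open>r < T\<close> by auto
    show "continuous_on {s..r} P"
      unfolding P_def using continuous_on_L2_pairing[OF v db_L2[of 0]] sub
      by (auto intro: continuous_on_subset)
    show "continuous_on {s..r} Q"
      unfolding Q_def by (rule continuous_on_subset[OF continuous_on_L2_pairing[OF v db_L2] sub])
    show "continuous_on {s..r} V"
      unfolding V_def by (rule continuous_on_subset[OF continuous_on_weighted_mass[OF v meas1 K1] sub])
    show "continuous_on {s..r} U"
      unfolding U_def by (rule continuous_on_subset[OF continuous_on_weighted_mass[OF u meas1 K1] sub])
  qed
  have cont_a: "continuous_on {s..r} a" "continuous_on {s..r} (deriv a)"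
    using smooth1_continuous_on[OF a, of _ 0] smooth1_continuous_on[OF a, of _ 1] by auto
  have int_g1: "integrable lborel g1"
    unfolding g1_def
    by (rule integrable_continuous_supported[of s r]) (auto intro!: continuous_intros cont cont_a simp: supp da_supp)
  have int_g2: "integrable lborel g2"
    unfolding g2_def
    by (rule integrable_continuous_supported[of s r]) (auto intro!: continuous_intros cont cont_a simp: supp)
  have h_eq: "h = (\<lambda>t. g1 t - g2 t)"
  proof
    fix t
    show "h t = g1 t - g2 t"
    proof (cases "t \<in> {s..r}")
      case True
      have "(LINT x|lborel. deriv b x * ((v t x)\<^sup>2 / 2 - \<gamma> * (cmod (u t x))\<^sup>2))
          = (LINT x|lborel. deriv b x * (norm (v t x))\<^sup>2 / 2 - \<gamma> * (deriv b x * (norm (u t x))\<^sup>2))"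
        by (simp add: algebra_simps)
      also have "\<dots> = V t / 2 - \<gamma> * U t"
        using int_V[OF True] int_U[OF True] by (simp add: V_def U_def)
      finally have "(LINT x|lborel. deriv b x * ((v t x)\<^sup>2 / 2 - \<gamma> * (cmod (u t x))\<^sup>2)) = V t / 2 - \<gamma> * U t" .
      then show ?thesis
        unfolding h_def g1_def g2_def P_def Q_def by (simp add: right_diff_distrib)
    qed (simp add: h_def g1_def g2_def supp da_supp)
  qed
  show "integrable lborel h"
    unfolding h_eq using int_g1 int_g2 by simp
  have lhs: "(LINT x|lborel. - pd_t \<phi> t x * v t x - (pd_x ^^ 3) \<phi> t x * v t x - pd_x \<phi> t x * ((v t x)\<^sup>2 / 2)) = - g1 t" for t
  proof (cases "t \<in> {s..r}")
    case True
    have "(LINT x|lborel. - pd_t \<phi> t x * v t x - (pd_x ^^ 3) \<phi> t x * v t x - pd_x \<phi> t x * ((v t x)\<^sup>2 / 2))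
        = (LINT x|lborel. - (deriv a t * (b x * v t x)) - a t * ((deriv ^^ 3) b x * v t x)
            - a t / 2 * (deriv b x * (norm (v t x))\<^sup>2))"
      by (simp add: pdt pdx pdx3 mult.assoc)
    also have "\<dots> = - g1 t"
      using int_P[OF True] int_Q[OF True] int_V[OF True] by (simp add: g1_def P_def Q_def V_def)
    finally show ?thesis .
  qed (simp add: g1_def pdt pdx pdx3 supp da_supp)
  have rhs: "(LINT x|lborel. - \<gamma> * pd_x \<phi> t x * (cmod (u t x))\<^sup>2) = - g2 t" for t
  proof -
    have "(LINT x|lborel. - \<gamma> * pd_x \<phi> t x * (cmod (u t x))\<^sup>2)
        = (LINT x|lborel. - (\<gamma> * a t) * (deriv b x * (norm (u t x))\<^sup>2))"
      by (simp add: pdx mult.assoc)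
    also have "\<dots> = - g2 t"
      unfolding integral_mult_right_zero by (simp add: g2_def U_def)
    finally show ?thesis .
  qed
  have "(LINT t|lborel. - g1 t) = (LINT t|lborel. - g2 t)"
    using kdv[unfolded kdv_eq_def, rule_format, OF \<open>test_fun2 T \<phi>\<close>] unfolding lhs rhs .
  then show "(LINT t|lborel. h t) = 0"
    unfolding h_eq using int_g1 int_g2 by simp
qed

text \<open>
  The integrand \<open>h\<close> of \<open>kdv_eq_separated\<close> has integral zero and is bounded below by \<open>(A - N\<^sub>3) a\<close>
  minus \<open>D N\<close> on the time interval.  Since \<open>A\<close> bounds the good term from below, this is an upper
  bound for the time-averaged flux in terms of quantities linear in \<open>v\<close>.
\<close>

lemma kdv_virial_inequality:
  fixes u :: "real \<Rightarrow> real \<Rightarrow> complex"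
  assumes kdv: "kdv_eq \<gamma> T u v" and u: "continuous_H1 T u" and v: "continuous_H1 T v"
    and a: "smooth1 a" and b: "test_fun1 b"
    and supp: "\<And>t. t \<notin> {s..r} \<Longrightarrow> a t = 0" and "0 < s" "s \<le> r" "r < T"
    and a_nonneg: "\<And>t. a t \<ge> 0" and a_deriv: "\<And>t. \<bar>deriv a t\<bar> \<le> D"
    and P: "\<And>t. t \<in> {s..r} \<Longrightarrow> \<bar>LINT x|lborel. b x * v t x\<bar> \<le> N"
    and Q: "\<And>t. t \<in> {s..r} \<Longrightarrow> \<bar>LINT x|lborel. (deriv ^^ 3) b x * v t x\<bar> \<le> N3"
    and W: "\<And>t. t \<in> {s..r} \<Longrightarrow> A \<le> (LINT x|lborel. deriv b x * ((v t x)\<^sup>2 / 2 - \<gamma> * (cmod (u t x))\<^sup>2))"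
  shows "(A - N3) * (LINT t|lborel. a t) \<le> D * N * (r - s)"
proof -
  define h where "h = (\<lambda>t. deriv a t * (LINT x|lborel. b x * v t x)
      + a t * (LINT x|lborel. (deriv ^^ 3) b x * v t x)
      + a t * (LINT x|lborel. deriv b x * ((v t x)\<^sup>2 / 2 - \<gamma> * (cmod (u t x))\<^sup>2)))"
  have h: "integrable lborel h" "(LINT t|lborel. h t) = 0"
    unfolding h_def
    using kdv_eq_separated[OF kdv u v a b supp \<open>0 < s\<close> \<open>r < T\<close>] by auto
  have int_a: "integrable lborel a"
    by (rule integrable_continuous_supported[of s r])
      (use smooth1_continuous_on[OF a, of _ 0] supp in auto)
  have int_s: "integrable lborel (indicat_real {s..r})"
    by (intro integrable_real_indicator) (auto simp: emeasure_lborel_Icc_eq)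
  have "(LINT t|lborel. (A - N3) * a t - D * N * indicator {s..r} t) \<le> (LINT t|lborel. h t)"
  proof (rule integral_mono)
    show "integrable lborel (\<lambda>t. (A - N3) * a t - D * N * indicator {s..r} t)"
      using int_a int_s by (intro Bochner_Integration.integrable_diff integrable_mult_right) 
    fix t
    show "(A - N3) * a t - D * N * indicator {s..r} t \<le> h t"
    proof (cases "t \<in> {s..r}")
      case True
      have "D \<ge> 0" using a_deriv[of 0] by linarith
      have "\<bar>deriv a t * (LINT x|lborel. b x * v t x)\<bar> \<le> D * N"
        unfolding abs_mult by (intro mult_mono a_deriv P True \<open>D \<ge> 0\<close>) simp
      moreover have "a t * - N3 \<le> a t * (LINT x|lborel. (deriv ^^ 3) b x * v t x)"
        using Q[OF True] by (intro mult_left_mono a_nonneg) linarith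
      moreover have "a t * A \<le> a t * (LINT x|lborel. deriv b x * ((v t x)\<^sup>2 / 2 - \<gamma> * (cmod (u t x))\<^sup>2))"
        by (intro mult_left_mono a_nonneg W True)
      ultimately show ?thesis
        using True by (simp add: h_def algebra_simps)
    next
      case False
      then show ?thesis
        using supp deriv_eq_0_outside[of s r a t] by (simp add: h_def)
    qed
  qed (rule h)
  then show ?thesis
    using h(2) int_a int_s \<open>s \<le> r\<close> by simp
qed

section \<open>Mass in a fixed window over a time interval\<close>

text \<open>
  Both steps have the same limits at \<open>\<plusminus>\<infinity>\<close>, so their difference has compact support although each
  of them increases.  Steps of the same height at scales \<open>l\<^sub>1\<close> and \<open>l\<^sub>2\<close> have slopes of order
  \<open>1/l\<^sub>1\<close> and \<open>1/l\<^sub>2\<close>; the second one is the price for the compact support.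
\<close>

lemma two_scale_cutoff:
  fixes c :: real
  assumes B: "smooth1 B" and l: "\<And>x. x \<le> -2 \<Longrightarrow> B x = B (-2)" and r: "\<And>x. x \<ge> 2 \<Longrightarrow> B x = B 2"
    and K0: "\<And>x. \<bar>B x\<bar> \<le> K0" and K3: "\<And>x. \<bar>(deriv ^^ 3) B x\<bar> \<le> K3"
    and "0 < l1" "l1 \<le> l2"
  obtains b where "test_fun1 b"
    "\<And>x. deriv b x = deriv B ((x - c) / l1) / l1 - deriv B ((x - c) / l2) / l2"
    "L2 b" "l2_norm b \<le> 4 * K0 * sqrt l2"
    "L2 ((deriv ^^ 3) b)" "l2_norm ((deriv ^^ 3) b) \<le> 4 * K3 / l1 ^ 3 * sqrt l2"
proof -
  define b where "b = (\<lambda>x. B ((x - c) / l1) - B ((x - c) / l2))"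
  have pos: "0 < l2" using assms by linarith
  have smooth: "smooth1 b"
    unfolding b_def by (intro smooth1_diff smooth1_affine B)
  have D: "(deriv ^^ n) b = (\<lambda>x. (deriv ^^ n) B ((x - c) / l1) / l1 ^ n - (deriv ^^ n) B ((x - c) / l2) / l2 ^ n)" for n
    unfolding b_def by (simp only: iterated_deriv_diff[OF smooth1_affine smooth1_affine, OF B B] iterated_deriv_affine[OF B])
  have deriv_b: "deriv b x = deriv B ((x - c) / l1) / l1 - deriv B ((x - c) / l2) / l2" for x
    using fun_cong[OF D[of 1], of x] by simp
  have supp: "b x = 0" if "\<bar>x - c\<bar> > 2 * l2" for x
  proof (cases "x > c")
    case True
    then have "(x - c) / l1 \<ge> 2" "(x - c) / l2 \<ge> 2"
      using that \<open>0 < l1\<close> \<open>l1 \<le> l2\<close> pos by (auto simp: field_simps)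
    then show ?thesis using r unfolding b_def by (metis diff_self)
  next
    case False
    then have "(x - c) / l1 \<le> -2" "(x - c) / l2 \<le> -2"
      using that \<open>0 < l1\<close> \<open>l1 \<le> l2\<close> pos by (auto simp: field_simps)
    then show ?thesis using l unfolding b_def by (metis diff_self)
  qed
  have supp_D: "(deriv ^^ n) b x = 0" if "\<bar>x - c\<bar> > 2 * l2" for n x
    using that
  proof (induction n arbitrary: x)
    case (Suc n)
    show ?case
      unfolding funpow.simps comp_apply
      by (rule deriv_eq_0_outside[of "c - 2 * l2" "c + 2 * l2"]; (rule Suc.IH)?)
        (use Suc.prems in auto)
  qed (use supp in simp)
  have meas: "(deriv ^^ n) b \<in> borel_measurable borel" for n
    by (intro borel_measurable_continuous_onI smooth1_continuous_on smooth)
  have "\<bar>x\<bar> \<le> \<bar>c\<bar> + 2 * l2" if "b x \<noteq> 0" for x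
    using supp[of x] that by linarith
  then have test_b: "test_fun1 b"
    using smooth by (auto simp: test_fun1_def bounded_iff)
  have sqrt4: "sqrt (2 * (2 * l2)) = 2 * sqrt l2"
    using real_sqrt_mult[of 4 l2] by simp
  have "\<bar>b x\<bar> \<le> 2 * K0" for x
    using K0[of "(x - c) / l1"] K0[of "(x - c) / l2"] unfolding b_def by linarith
  note L2_bounded_support[where c = c and r = "2 * l2", OF meas[of 0, simplified] this supp]
  then have b_L2: "L2 b" "l2_norm b \<le> 4 * K0 * sqrt l2"
    using pos sqrt4 by auto
  have "\<bar>(deriv ^^ 3) b x\<bar> \<le> 2 * K3 / l1 ^ 3" for x
  proof -
    have "K3 \<ge> 0" using K3[of 0] by linarith
    have "\<bar>(deriv ^^ 3) B ((x - c) / l1) / l1 ^ 3\<bar> \<le> K3 / l1 ^ 3"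
      using K3 \<open>0 < l1\<close> by (simp add: divide_right_mono)
    moreover have "\<bar>(deriv ^^ 3) B ((x - c) / l2) / l2 ^ 3\<bar> \<le> K3 / l1 ^ 3"
      using K3 \<open>0 < l1\<close> \<open>l1 \<le> l2\<close> \<open>K3 \<ge> 0\<close> by (auto simp: power_mono intro!: frac_le)
    ultimately show ?thesis
      unfolding D[of 3] by linarith
  qed
  note L2_bounded_support[where c = c and r = "2 * l2", OF meas[of 3] this supp_D[of _ 3]]
  then have "L2 ((deriv ^^ 3) b)" "l2_norm ((deriv ^^ 3) b) \<le> 4 * K3 / l1 ^ 3 * sqrt l2"
    using pos sqrt4 by auto
  then show thesis
    by (rule that[OF test_b deriv_b b_L2])
qed

text \<open>
  The slope of the step, rescaled from \<open>[-2, 2]\<close> to \<open>[s, s + L]\<close>, serves as the bump in time; it is at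
  least \<open>1\<close> on the middle half of the interval.
\<close>

lemma time_cutoff:
  fixes s :: real
  assumes B: "smooth1 B" and "\<And>x. deriv B x \<ge> 0" "\<And>x. \<bar>x\<bar> \<le> 1 \<Longrightarrow> deriv B x \<ge> 1"
    "\<And>x. \<bar>x\<bar> \<ge> 2 \<Longrightarrow> deriv B x = 0" and K2: "\<And>x. \<bar>(deriv ^^ 2) B x\<bar> \<le> K2" and "L > 0"
  obtains a where "smooth1 a" "\<And>t. a t \<ge> 0" "\<And>t. t \<notin> {s..s + L} \<Longrightarrow> a t = 0"
    "\<And>t. \<bar>deriv a t\<bar> \<le> 4 * K2 / L" "L / 2 \<le> (LINT t|lborel. a t)"
proof -
  define a where "a = (\<lambda>t. deriv B ((t - (s + L / 2)) / (L / 4)))"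
  have B': "smooth1 (deriv B)" using smooth1_deriv[OF B, of 1] by simp
  have smooth: "smooth1 a"
    unfolding a_def by (rule smooth1_affine[OF B'])
  have nonneg: "a t \<ge> 0" for t
    using assms by (simp add: a_def)
  have supp: "a t = 0" if "t \<notin> {s..s + L}" for t
  proof -
    have "2 \<le> \<bar>(t - (s + L / 2)) / (L / 4)\<bar>"
      using that \<open>L > 0\<close> by (auto simp: field_simps abs_if)
    then show ?thesis unfolding a_def by (rule assms)
  qed
  have deriv_a: "\<bar>deriv a t\<bar> \<le> 4 * K2 / L" for t
  proof -
    have "deriv a t = (deriv ^^ 2) B ((t - (s + L / 2)) / (L / 4)) / (L / 4)"
      using fun_cong[OF iterated_deriv_affine[OF B', of 1 "s + L / 2" "L / 4"], of t]
      by (simp add: a_def numeral_2_eq_2)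
    moreover have "\<bar>(deriv ^^ 2) B ((t - (s + L / 2)) / (L / 4)) / (L / 4)\<bar> \<le> K2 / (L / 4)"
      unfolding abs_divide using K2 \<open>L > 0\<close> by (simp add: divide_right_mono)
    ultimately show ?thesis by (simp add: mult.commute)
  qed
  have "(LINT t|lborel. indicat_real {s + L / 4..s + 3 * L / 4} t) \<le> (LINT t|lborel. a t)"
  proof (rule integral_mono)
    show "integrable lborel a"
      by (rule integrable_continuous_supported[of s "s + L"])
        (use smooth1_continuous_on[OF smooth, of _ 0] supp in auto)
    show "integrable lborel (indicat_real {s + L / 4..s + 3 * L / 4})"
      by (intro integrable_real_indicator) (auto simp: emeasure_lborel_Icc_eq)
    fix t
    have "1 \<le> a t" if "t \<in> {s + L / 4..s + 3 * L / 4}"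
    proof -
      have "\<bar>(t - (s + L / 2)) / (L / 4)\<bar> \<le> 1"
        using that \<open>L > 0\<close> by (auto simp: field_simps abs_if)
      then show ?thesis unfolding a_def by (rule assms)
    qed
    then show "indicat_real {s + L / 4..s + 3 * L / 4} t \<le> a t"
      using nonneg[of t] by (auto simp: indicator_def)
  qed
  then have "L / 2 \<le> (LINT t|lborel. a t)"
    using \<open>L > 0\<close> by simp
  then show thesis
    using that smooth nonneg supp deriv_a by blast
qed

text \<open>
  The three terms on the right are the costs of switching the weight on and off in time, of the
  dispersive term \<open>\<partial>\<^sub>x\<^sup>3 b\<close>, and of the decreasing part of the weight, each relative to the slope
  \<open>1/l\<^sub>1\<close> with which the mass in the window is counted.
\<close>

lemma kdv_window_estimate:
  fixes u :: "real \<Rightarrow> real \<Rightarrow> complex"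
  assumes kdv: "\<And>T. T > 0 \<Longrightarrow> kdv_eq \<gamma> T u v" and u: "\<And>T. T > 0 \<Longrightarrow> continuous_H1 T u"
    and v: "\<And>T. T > 0 \<Longrightarrow> continuous_H1 T v" and "\<gamma> < 0"
    and uM: "\<And>t. t \<ge> 0 \<Longrightarrow> l2_norm (u t) \<le> M" and vM: "\<And>t. t \<ge> 0 \<Longrightarrow> l2_norm (v t) \<le> M"
  obtains K :: real where
    "\<And>s L c l1 l2 \<epsilon>. \<lbrakk>0 < s; 0 < L; 0 < l1; l1 \<le> l2;
       \<And>t. t \<in> {s..s + L} \<Longrightarrow>
         \<epsilon> \<le> (LINT x:{c - l1..c + l1}|lborel. (v t x)\<^sup>2 / 2 - \<gamma> * (cmod (u t x))\<^sup>2)\<rbrakk>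
      \<Longrightarrow> \<epsilon> \<le> K * (l1 * sqrt l2 / L + sqrt l2 / l1\<^sup>2 + l1 / l2)"
proof -
  obtain B where B: "smooth1 B" "\<And>x. deriv B x \<ge> 0" "\<And>x. \<bar>x\<bar> \<le> 1 \<Longrightarrow> deriv B x \<ge> 1"
    "\<And>x. \<bar>x\<bar> \<ge> 2 \<Longrightarrow> deriv B x = 0" "\<And>x. x \<le> -2 \<Longrightarrow> B x = B (-2)" "\<And>x. x \<ge> 2 \<Longrightarrow> B x = B 2"
    using smooth_step_exists by blast
  have bounds: "\<exists>K>0. \<forall>x. \<bar>(deriv ^^ n) B x\<bar> \<le> K" for n
    by (rule bounded_derivs_of_smooth_const_outside[where p = "B (- 2)" and q = "B 2" and n = n, OF B(1,5,6)]) auto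
  obtain K0 where K0: "K0 > 0" "\<And>x. \<bar>(deriv ^^ 0) B x\<bar> \<le> K0" using bounds[of 0] by blast
  obtain K1 where K1: "K1 > 0" "\<And>x. \<bar>(deriv ^^ 1) B x\<bar> \<le> K1" using bounds[of 1] by blast
  obtain K2 where K2: "K2 > 0" "\<And>x. \<bar>(deriv ^^ 2) B x\<bar> \<le> K2" using bounds[of 2] by blast
  obtain K3 where K3: "K3 > 0" "\<And>x. \<bar>(deriv ^^ 3) B x\<bar> \<le> K3" using bounds[of 3] by blast
  have "M \<ge> 0"
    using order_trans[OF l2_norm_nonneg uM[of 0]] by simp
  define K where "K = 32 * K0 * K2 * M + 4 * K3 * M + K1 * ((1 - \<gamma>) * M\<^sup>2)"
  show thesis
  proof (rule that[of K])
    fix s L c l1 l2 \<epsilon> :: real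
    assume "0 < s" "0 < L" "0 < l1" "l1 \<le> l2"
      and \<epsilon>: "\<And>t. t \<in> {s..s + L} \<Longrightarrow>
         \<epsilon> \<le> (LINT x:{c - l1..c + l1}|lborel. (v t x)\<^sup>2 / 2 - \<gamma> * (cmod (u t x))\<^sup>2)"
    define T where "T = s + L + 1"
    have "T > 0" "s + L < T" using \<open>0 < s\<close> \<open>0 < L\<close> by (auto simp: T_def)
    define w where "w = (\<lambda>t x. (v t x)\<^sup>2 / 2 - \<gamma> * (cmod (u t x))\<^sup>2)"
    have "0 < l2" using \<open>0 < l1\<close> \<open>l1 \<le> l2\<close> by linarith
    obtain b where b: "test_fun1 b"
      "\<And>x. deriv b x = deriv B ((x - c) / l1) / l1 - deriv B ((x - c) / l2) / l2"
      "L2 b" "l2_norm b \<le> 4 * K0 * sqrt l2"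
      "L2 ((deriv ^^ 3) b)" "l2_norm ((deriv ^^ 3) b) \<le> 4 * K3 / l1 ^ 3 * sqrt l2"
      using two_scale_cutoff[where c = c, OF B(1) _ _ K0(2)[simplified] K3(2) \<open>0 < l1\<close> \<open>l1 \<le> l2\<close>] B(5,6)
      by blast
    obtain a where a: "smooth1 a" "\<And>t. a t \<ge> 0" "\<And>t. t \<notin> {s..s + L} \<Longrightarrow> a t = 0"
      "\<And>t. \<bar>deriv a t\<bar> \<le> 4 * K2 / L" "L / 2 \<le> (LINT t|lborel. a t)"
      using time_cutoff[where s = s, OF B(1,2) _ _ K2(2) \<open>0 < L\<close>] B(3,4) by blast
    have t: "t \<in> {0..T}" if "t \<in> {s..s + L}" for t
      using that \<open>0 < s\<close> \<open>s + L < T\<close> by auto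
    define N where "N = 4 * K0 * sqrt l2 * M"
    define N3 where "N3 = 4 * K3 / l1 ^ 3 * sqrt l2 * M"
    define E where "E = K1 / l2 * ((1 - \<gamma>) * M\<^sup>2)"
    have "(\<epsilon> / l1 - E - N3) * (LINT t|lborel. a t) \<le> 4 * K2 / L * N * (s + L - s)"
    proof (rule kdv_virial_inequality[OF kdv[OF \<open>T > 0\<close>] u[OF \<open>T > 0\<close>] v[OF \<open>T > 0\<close>] a(1) b(1) a(3) \<open>0 < s\<close> _ \<open>s + L < T\<close> a(2) a(4)])
      show "s \<le> s + L" using \<open>0 < L\<close> by simp
      fix t assume ts: "t \<in> {s..s + L}"
      have "t \<ge> 0" using ts \<open>0 < s\<close> by simp
      note ut = continuous_H1_L2[OF u[OF \<open>T > 0\<close>] t[OF ts]] and vt = continuous_H1_L2[OF v[OF \<open>T > 0\<close>] t[OF ts]]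
      have "\<bar>LINT x|lborel. b x * v t x\<bar> \<le> l2_norm b * l2_norm (v t)"
        by (rule L2_Cauchy_Schwarz[OF b(3) vt])
      also have "\<dots> \<le> N"
        unfolding N_def by (intro mult_mono b vM \<open>t \<ge> 0\<close>) (use K0 \<open>0 < l2\<close> in auto)
      finally show "\<bar>LINT x|lborel. b x * v t x\<bar> \<le> N" .
      have "\<bar>LINT x|lborel. (deriv ^^ 3) b x * v t x\<bar> \<le> l2_norm ((deriv ^^ 3) b) * l2_norm (v t)"
        by (rule L2_Cauchy_Schwarz[OF b(5) vt])
      also have "\<dots> \<le> N3"
        unfolding N3_def by (intro mult_mono b vM \<open>t \<ge> 0\<close>) (use K3 \<open>0 < l1\<close> \<open>0 < l2\<close> in auto)
      finally show "\<bar>LINT x|lborel. (deriv ^^ 3) b x * v t x\<bar> \<le> N3" .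
      have w_nonneg: "w t x \<ge> 0" for x
        using \<open>\<gamma> < 0\<close> mult_nonpos_nonneg[of \<gamma> "(cmod (u t x))\<^sup>2", OF less_imp_le zero_le_power2] zero_le_power2[of "v t x"]
        unfolding w_def by linarith
      have int_v: "integrable lborel (\<lambda>x. (v t x)\<^sup>2)" and int_u: "integrable lborel (\<lambda>x. (cmod (u t x))\<^sup>2)"
        using ut vt by (auto simp: L2_def)
      then have int_w: "integrable lborel (w t)" by (simp add: w_def)
      have "(LINT x|lborel. w t x) = (l2_norm (v t))\<^sup>2 / 2 - \<gamma> * (l2_norm (u t))\<^sup>2"
        using int_u int_v by (simp add: w_def l2_norm_power2)
      also have "\<dots> \<le> M\<^sup>2 - \<gamma> * M\<^sup>2"
      proof -
        have "(l2_norm (v t))\<^sup>2 \<le> M\<^sup>2" "(l2_norm (u t))\<^sup>2 \<le> M\<^sup>2"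
          using uM[OF \<open>t \<ge> 0\<close>] vM[OF \<open>t \<ge> 0\<close>] by (auto intro: power_mono)
        moreover from this have "- \<gamma> * (l2_norm (u t))\<^sup>2 \<le> - \<gamma> * M\<^sup>2"
          using \<open>\<gamma> < 0\<close> by (intro mult_left_mono) auto
        ultimately show ?thesis using zero_le_power2[of "l2_norm (v t)"] by linarith
      qed
      finally have mass: "(LINT x|lborel. w t x) \<le> (1 - \<gamma>) * M\<^sup>2" by (simp add: algebra_simps)
      have int_I: "integrable lborel (\<lambda>x. indicat_real {c - l1..c + l1} x * w t x)"
        using integrable_mult_indicator[of "{c - l1..c + l1}" lborel, OF _ int_w] by simp
      have deriv_b_bound: "\<bar>deriv b x\<bar> \<le> K1 / l1 + K1 / l2" for x
      proof -
        have "\<bar>deriv B ((x - c) / l1) / l1\<bar> \<le> K1 / l1" "\<bar>deriv B ((x - c) / l2) / l2\<bar> \<le> K1 / l2"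
          using K1(2) \<open>0 < l1\<close> \<open>0 < l2\<close> by (auto simp: divide_right_mono)
        then show ?thesis unfolding b(2) by linarith
      qed
      have meas: "deriv b \<in> borel_measurable borel"
        using b(1) smooth1_continuous_on[of b UNIV 1] by (auto simp: test_fun1_def intro: borel_measurable_continuous_onI)
      have "\<epsilon> / l1 - E \<le> (LINT x|lborel. indicat_real {c - l1..c + l1} x * w t x) / l1 - K1 / l2 * (LINT x|lborel. w t x)"
      proof -
        have "\<epsilon> / l1 \<le> (LINT x|lborel. indicat_real {c - l1..c + l1} x * w t x) / l1"
          using \<epsilon>[OF ts] \<open>0 < l1\<close> by (intro divide_right_mono) (auto simp: set_lebesgue_integral_def w_def)
        moreover have "K1 / l2 * (LINT x|lborel. w t x) \<le> E"
          unfolding E_def using K1(1) \<open>0 < l2\<close> by (intro mult_left_mono mass) auto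
        ultimately show ?thesis by linarith
      qed
      also have "\<dots> = (LINT x|lborel. (indicat_real {c - l1..c + l1} x * w t x) / l1 - K1 / l2 * w t x)"
        using int_I int_w by simp
      also have "\<dots> \<le> (LINT x|lborel. deriv b x * w t x)"
      proof (rule integral_mono)
        show "integrable lborel (\<lambda>x. (indicat_real {c - l1..c + l1} x * w t x) / l1 - K1 / l2 * w t x)"
          using int_I int_w by simp
        have "integrable lborel (\<lambda>x. deriv b x * (norm (v t x))\<^sup>2 / 2 - \<gamma> * (deriv b x * (norm (u t x))\<^sup>2))"
          using integrable_bounded_mult_power2[OF ut meas deriv_b_bound] integrable_bounded_mult_power2[OF vt meas deriv_b_bound]
          by simp
        then show "integrable lborel (\<lambda>x. deriv b x * w t x)"
          by (rule back_subst[of "integrable lborel"]) (auto simp: w_def algebra_simps)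
        fix x
        have "indicat_real {c - l1..c + l1} x / l1 - K1 / l2 \<le> deriv b x"
        proof -
          have "indicat_real {c - l1..c + l1} x / l1 \<le> deriv B ((x - c) / l1) / l1"
          proof (intro divide_right_mono)
            show "indicat_real {c - l1..c + l1} x \<le> deriv B ((x - c) / l1)"
            proof (cases "x \<in> {c - l1..c + l1}")
              case True
              then have "\<bar>(x - c) / l1\<bar> \<le> 1" using \<open>0 < l1\<close> by (auto simp: abs_le_iff field_simps)
              then show ?thesis using B(3) True by simp
            qed (use B(2) in simp)
          qed (use \<open>0 < l1\<close> in simp)
          moreover have "deriv B ((x - c) / l2) / l2 \<le> K1 / l2"
            using K1(2)[of "(x - c) / l2"] \<open>0 < l2\<close> by (intro divide_right_mono) auto
          ultimately show ?thesis unfolding b(2) by linarith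
        qed
        from mult_right_mono[OF this w_nonneg[of x]]
        show "(indicat_real {c - l1..c + l1} x * w t x) / l1 - K1 / l2 * w t x \<le> deriv b x * w t x"
          by (simp add: algebra_simps)
      qed
      finally show "\<epsilon> / l1 - E \<le> (LINT x|lborel. deriv b x * ((v t x)\<^sup>2 / 2 - \<gamma> * (cmod (u t x))\<^sup>2))"
        by (simp add: w_def)
    qed
    then have virial: "(\<epsilon> / l1 - E - N3) * (LINT t|lborel. a t) \<le> 4 * K2 * N"
      using \<open>0 < L\<close> by simp
    have "N \<ge> 0" using K0 \<open>M \<ge> 0\<close> \<open>0 < l2\<close> by (simp add: N_def)
    \<comment> \<open>Only if the left-hand side is nonnegative may the integral of \<open>a\<close> be replaced by its lower bound.\<close>
    have "\<epsilon> / l1 - E - N3 \<le> 8 * K2 * N / L"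
    proof (cases "\<epsilon> / l1 - E - N3 \<ge> 0")
      case True
      have "(\<epsilon> / l1 - E - N3) * (L / 2) \<le> (\<epsilon> / l1 - E - N3) * (LINT t|lborel. a t)"
        by (intro mult_left_mono a True)
      with virial have "(\<epsilon> / l1 - E - N3) * (L / 2) \<le> 4 * K2 * N" by linarith
      then show ?thesis using \<open>0 < L\<close> by (simp add: field_simps)
    next
      case False
      moreover have "0 \<le> 8 * K2 * N / L" using K2 \<open>N \<ge> 0\<close> \<open>0 < L\<close> by simp
      ultimately show ?thesis by linarith
    qed
    then have "\<epsilon> / l1 * l1 \<le> (8 * K2 * N / L + N3 + E) * l1"
      using \<open>0 < l1\<close> by (intro mult_right_mono) auto
    also have "(8 * K2 * N / L + N3 + E) * l1
        = 32 * K0 * K2 * M * (l1 * sqrt l2 / L) + 4 * K3 * M * (sqrt l2 / l1\<^sup>2) + K1 * ((1 - \<gamma>) * M\<^sup>2) * (l1 / l2)"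
    proof -
      have "8 * K2 * N / L * l1 = 32 * K0 * K2 * M * (l1 * sqrt l2 / L)"
        by (simp add: N_def)
      moreover have "N3 * l1 = 4 * K3 * M * (sqrt l2 / l1\<^sup>2)"
        using \<open>0 < l1\<close> by (simp add: N3_def power2_eq_square power3_eq_cube)
      moreover have "E * l1 = K1 * ((1 - \<gamma>) * M\<^sup>2) * (l1 / l2)"
        by (simp add: E_def)
      ultimately show ?thesis by (simp only: distrib_right)
    qed
    also have "\<dots> \<le> K * (l1 * sqrt l2 / L) + K * (sqrt l2 / l1\<^sup>2) + K * (l1 / l2)"
      unfolding K_def using K0 K1 K2 K3 \<open>0 < l1\<close> \<open>0 < l2\<close> \<open>0 < L\<close> \<open>M \<ge> 0\<close> \<open>\<gamma> < 0\<close>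
      by (intro add_mono mult_right_mono) auto
    finally show "\<epsilon> \<le> K * (l1 * sqrt l2 / L + sqrt l2 / l1\<^sup>2 + l1 / l2)"
      using \<open>0 < l1\<close> by (simp add: distrib_left)
  qed
qed

section \<open>Windows that contain the moving region\<close>

lemma Gamma_region_eq: "Gamma_region C m p t = {t powr m - C * t powr p..t powr m + C * t powr p}"
  by (auto simp: Gamma_region_def abs_le_iff)

text \<open>
  During the time \<open>R\<^sup>l \<le> R\<close> the half-width \<open>C t\<^sup>p\<close> at most doubles, and the centre moves by at most
  \<open>R\<^sup>p\<close>: since \<open>m \<le> 1\<close>, the bound \<open>(t/R)\<^sup>m \<le> t/R\<close> gives \<open>t\<^sup>m - R\<^sup>m \<le> (t - R) R\<^sup>m\<^sup>-\<^sup>1\<close>.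
\<close>

lemma Gamma_region_subset_window:
  assumes "0 < p" "p \<le> 1" "0 < m" "m \<le> 1" "C > 0" "1 \<le> R" "l \<le> 1" "l \<le> p + 1 - m"
    and t: "t \<in> {R..R + R powr l}"
  shows "Gamma_region C m p t \<subseteq> {R powr m - (2 * C + 1) * R powr p..R powr m + (2 * C + 1) * R powr p}"
proof -
  have "R powr l \<le> R"
    using powr_mono[OF \<open>l \<le> 1\<close> \<open>1 \<le> R\<close>] \<open>1 \<le> R\<close> by simp
  then have "R \<le> t" "t \<le> 2 * R" using t by auto
  have "t powr p \<le> (2 * R) powr p"
    using \<open>R \<le> t\<close> \<open>t \<le> 2 * R\<close> assms by (intro powr_mono2) auto
  also have "\<dots> \<le> 2 * R powr p"
    using assms powr_mono[of p 1 "2::real"] by (simp add: powr_mult mult_right_mono)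
  finally have width: "C * t powr p \<le> 2 * C * R powr p" using \<open>C > 0\<close> by simp
  have "t powr m = (t / R) powr m * R powr m"
    using \<open>R \<le> t\<close> \<open>1 \<le> R\<close> by (simp add: powr_divide)
  also have "\<dots> \<le> (t / R) * R powr m"
    using powr_mono[of m 1 "t / R"] assms \<open>R \<le> t\<close> by (intro mult_right_mono) auto
  also have "\<dots> = R powr m + (t - R) * R powr (m - 1)"
    using \<open>1 \<le> R\<close> by (simp add: powr_diff field_simps)
  also have "\<dots> \<le> R powr m + R powr l * R powr (m - 1)"
    using t by (intro add_left_mono mult_right_mono) auto
  also have "R powr l * R powr (m - 1) = R powr (l + m - 1)"
    by (simp add: powr_add[symmetric] add_diff_eq)
  also have "\<dots> \<le> R powr p"
    using assms by (intro powr_mono) auto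
  finally have "t powr m \<le> R powr m + R powr p" by simp
  moreover have "R powr m \<le> t powr m"
    using \<open>R \<le> t\<close> assms by (intro powr_mono2) auto
  ultimately show ?thesis
    using width by (auto simp: Gamma_region_eq algebra_simps)
qed

lemma window_error_tendsto_0:
  fixes k p q l :: real
  assumes "k > 0" "p + q / 2 < l" "q / 2 < 2 * p" "p < q"
  shows "((\<lambda>R. (k * R powr p) * sqrt (k * R powr q) / R powr l
      + sqrt (k * R powr q) / (k * R powr p)\<^sup>2
      + (k * R powr p) / (k * R powr q)) \<longlongrightarrow> 0) at_top"
proof -
  have "((\<lambda>R. k * sqrt k * R powr (p + q / 2 - l) + sqrt k / k\<^sup>2 * R powr (q / 2 - 2 * p)
      + R powr (p - q)) \<longlongrightarrow> k * sqrt k * 0 + sqrt k / k\<^sup>2 * 0 + 0) at_top"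
    by (intro tendsto_intros tendsto_neg_powr filterlim_ident) (use assms in auto)
  then have lim: "((\<lambda>R. k * sqrt k * R powr (p + q / 2 - l) + sqrt k / k\<^sup>2 * R powr (q / 2 - 2 * p)
      + R powr (p - q)) \<longlongrightarrow> 0) at_top" by simp
  show ?thesis
  proof (rule Lim_transform_eventually[OF lim])
    show "\<forall>\<^sub>F R in at_top. k * sqrt k * R powr (p + q / 2 - l) + sqrt k / k\<^sup>2 * R powr (q / 2 - 2 * p)
        + R powr (p - q) = (k * R powr p) * sqrt (k * R powr q) / R powr l
      + sqrt (k * R powr q) / (k * R powr p)\<^sup>2
      + (k * R powr p) / (k * R powr q)"
      using eventually_gt_at_top[of 0]
    proof eventually_elim
      fix R :: real assume "0 < R"
      then have "sqrt (k * R powr q) = sqrt k * R powr (q / 2)"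
        by (simp add: real_sqrt_mult powr_half_sqrt[symmetric] powr_powr)
      moreover have "(R powr p)\<^sup>2 = R powr (2 * p)"
        using \<open>0 < R\<close> by (simp add: powr_power mult.commute)
      ultimately show "k * sqrt k * R powr (p + q / 2 - l) + sqrt k / k\<^sup>2 * R powr (q / 2 - 2 * p)
        + R powr (p - q) = (k * R powr p) * sqrt (k * R powr q) / R powr l
      + sqrt (k * R powr q) / (k * R powr p)\<^sup>2
      + (k * R powr p) / (k * R powr q)"
        using \<open>k > 0\<close> \<open>0 < R\<close> by (simp add: powr_add powr_diff power_mult_distrib ac_simps)
    qed
  qed
qed

text \<open>
  Otherwise the window estimate applies on \<open>[R, R + R\<^sup>l]\<close> for every large \<open>R\<close> with the same
  \<open>\<epsilon>\<close>, although its right-hand side tends to \<open>0\<close>.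
\<close>

lemma mass_in_moving_window_small:
  fixes u :: "real \<Rightarrow> real \<Rightarrow> complex"
  assumes kdv: "\<And>T. T > 0 \<Longrightarrow> kdv_eq \<gamma> T u v" and u: "\<And>T. T > 0 \<Longrightarrow> continuous_H1 T u"
    and v: "\<And>T. T > 0 \<Longrightarrow> continuous_H1 T v" and "\<gamma> < 0"
    and uM: "\<And>t. t \<ge> 0 \<Longrightarrow> l2_norm (u t) \<le> M" and vM: "\<And>t. t \<ge> 0 \<Longrightarrow> l2_norm (v t) \<le> M"
    and p: "0 < p" "p < 2 / 3" and m: "0 < m" "m < 1 - p / 2" and "C > 0" and "\<epsilon> > 0"
  shows "\<exists>t\<ge>T0. (LINT x:Gamma_region C m p t|lborel. (v t x)\<^sup>2 / 2 - \<gamma> * (cmod (u t x))\<^sup>2) < \<epsilon>"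
proof (rule ccontr)
  assume "\<not> ?thesis"
  then have large: "\<epsilon> \<le> (LINT x:Gamma_region C m p t|lborel. (v t x)\<^sup>2 / 2 - \<gamma> * (cmod (u t x))\<^sup>2)" if "t \<ge> T0" for t
    using that by (auto simp: not_less)
  obtain K where K: "\<And>s L c l1 l2 \<epsilon>. \<lbrakk>0 < s; 0 < L; 0 < l1; l1 \<le> l2;
       \<And>t. t \<in> {s..s + L} \<Longrightarrow>
         \<epsilon> \<le> (LINT x:{c - l1..c + l1}|lborel. (v t x)\<^sup>2 / 2 - \<gamma> * (cmod (u t x))\<^sup>2)\<rbrakk>
      \<Longrightarrow> \<epsilon> \<le> K * (l1 * sqrt l2 / L + sqrt l2 / l1\<^sup>2 + l1 / l2)"
    using kdv_window_estimate[OF kdv u v \<open>\<gamma> < 0\<close> uM vM] by blast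
  \<comment> \<open>The longest duration for which the window covers the region.  As it exceeds
    \<open>3 p / 2\<close>, some \<open>q > p\<close> satisfies \<open>p + q / 2 < l\<close> and \<open>q < 4 p\<close>.\<close>
  define l where "l = min 1 (p + 1 - m)"
  define q where "q = p + min p (l - 3 * p / 2)"
  define k where "k = 2 * C + 1"
  have l: "3 * p / 2 < l" "l \<le> 1" "l \<le> p + 1 - m" using p m by (auto simp: l_def)
  have "p < q" "q \<le> l - p / 2" "q \<le> 2 * p" using l p by (auto simp: q_def)
  then have q: "p < q" "p + q / 2 < l" "q / 2 < 2 * p" using l p by linarith+
  have "k > 0" using \<open>C > 0\<close> by (simp add: k_def)
  define err where "err = (\<lambda>R. (k * R powr p) * sqrt (k * R powr q) / R powr l
      + sqrt (k * R powr q) / (k * R powr p)\<^sup>2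
      + (k * R powr p) / (k * R powr q))"
  have lower: "\<epsilon> \<le> K * err R" if "R \<ge> max 1 T0" for R
    unfolding err_def
  proof (rule K[where c = "R powr m"])
    have "R \<ge> 1" "R \<ge> T0" using that by auto
    show "k * R powr p \<le> k * R powr q"
      using \<open>R \<ge> 1\<close> q \<open>k > 0\<close> by (intro mult_left_mono powr_mono) auto
    fix t assume t: "t \<in> {R..R + R powr l}"
    then have "t \<ge> 0" "t \<ge> T0" using \<open>R \<ge> 1\<close> \<open>R \<ge> T0\<close> by auto
    have sub: "Gamma_region C m p t \<subseteq> {R powr m - k * R powr p..R powr m + k * R powr p}"
      unfolding k_def by (rule Gamma_region_subset_window[of p m C R l]) (use p m l t \<open>C > 0\<close> \<open>R \<ge> 1\<close> in auto)
    have w_int: "integrable lborel (\<lambda>x. (v t x)\<^sup>2 / 2 - \<gamma> * (cmod (u t x))\<^sup>2)"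
    proof -
      have "L2 (u t)" "L2 (v t)"
        using continuous_H1_L2[OF u[of "t + 1"], of t] continuous_H1_L2[OF v[of "t + 1"], of t] \<open>t \<ge> 0\<close> by auto
      then show ?thesis by (simp add: L2_def)
    qed
    have "\<epsilon> \<le> (LINT x:Gamma_region C m p t|lborel. (v t x)\<^sup>2 / 2 - \<gamma> * (cmod (u t x))\<^sup>2)"
      by (rule large[OF \<open>t \<ge> T0\<close>])
    also have "\<dots> \<le> (LINT x:{R powr m - k * R powr p..R powr m + k * R powr p}|lborel. (v t x)\<^sup>2 / 2 - \<gamma> * (cmod (u t x))\<^sup>2)"
      unfolding set_lebesgue_integral_def
    proof (rule integral_mono)
      show "integrable lborel (\<lambda>x. indicat_real (Gamma_region C m p t) x *\<^sub>R ((v t x)\<^sup>2 / 2 - \<gamma> * (cmod (u t x))\<^sup>2))"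
        by (rule integrable_mult_indicator[OF _ w_int]) (simp add: Gamma_region_eq)
      show "integrable lborel (\<lambda>x. indicat_real {R powr m - k * R powr p..R powr m + k * R powr p} x *\<^sub>R ((v t x)\<^sup>2 / 2 - \<gamma> * (cmod (u t x))\<^sup>2))"
        by (rule integrable_mult_indicator[OF _ w_int]) simp
      fix x
      have "0 \<le> (v t x)\<^sup>2 / 2 - \<gamma> * (cmod (u t x))\<^sup>2"
        using \<open>\<gamma> < 0\<close> mult_nonpos_nonneg[of \<gamma> "(cmod (u t x))\<^sup>2", OF less_imp_le zero_le_power2] zero_le_power2[of "v t x"] by linarith
      moreover have "indicat_real (Gamma_region C m p t) x \<le> indicat_real {R powr m - k * R powr p..R powr m + k * R powr p} x"
        using sub by (auto simp: indicator_def)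
      ultimately show "indicat_real (Gamma_region C m p t) x *\<^sub>R ((v t x)\<^sup>2 / 2 - \<gamma> * (cmod (u t x))\<^sup>2)
          \<le> indicat_real {R powr m - k * R powr p..R powr m + k * R powr p} x *\<^sub>R ((v t x)\<^sup>2 / 2 - \<gamma> * (cmod (u t x))\<^sup>2)"
        by (intro scaleR_right_mono)
    qed
    finally show "\<epsilon> \<le> (LINT x:{R powr m - k * R powr p..R powr m + k * R powr p}|lborel. (v t x)\<^sup>2 / 2 - \<gamma> * (cmod (u t x))\<^sup>2)" .
  qed (use that \<open>\<gamma> < 0\<close> \<open>k > 0\<close> in auto)
  have "(err \<longlongrightarrow> 0) at_top"
    unfolding err_def by (rule window_error_tendsto_0[OF \<open>k > 0\<close> q(2,3,1)])
  then have "((\<lambda>R. K * err R) \<longlongrightarrow> K * 0) at_top"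
    by (intro tendsto_intros)
  then have "\<forall>\<^sub>F R in at_top. K * err R < \<epsilon>"
    using \<open>\<epsilon> > 0\<close> by (intro order_tendstoD) auto
  then obtain R where "R \<ge> max 1 T0" "K * err R < \<epsilon>"
    unfolding eventually_at_top_linorder by (meson max.cobounded1 max.cobounded2)
  with lower show False by fastforce
qed

section \<open>Vanishing of the lower limits\<close>

lemma Liminf_at_top_eq_0I:
  fixes F :: "real \<Rightarrow> real"
  assumes nonneg: "\<And>t. F t \<ge> 0" and small: "\<And>\<epsilon> T0. \<epsilon> > 0 \<Longrightarrow> \<exists>t\<ge>T0. F t < \<epsilon>"
  shows "Liminf at_top (\<lambda>t. ereal (F t)) = 0"
proof (rule antisym)
  show "0 \<le> Liminf at_top (\<lambda>t. ereal (F t))"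
    by (rule Liminf_bounded) (simp add: nonneg)
  show "Liminf at_top (\<lambda>t. ereal (F t)) \<le> 0"
  proof (rule ccontr)
    assume "\<not> ?thesis"
    then obtain \<epsilon> where "0 < ereal \<epsilon>" "ereal \<epsilon> < Liminf at_top (\<lambda>t. ereal (F t))"
      using ereal_dense2 by (metis not_le)
    then have "\<forall>\<^sub>F t in at_top. \<epsilon> < F t" 
      using less_LiminfD[of "ereal \<epsilon>" at_top "\<lambda>t. ereal (F t)"] by simp
    then obtain T0 where "\<And>t. t \<ge> T0 \<Longrightarrow> \<epsilon> < F t"
      by (auto simp: eventually_at_top_linorder)
    then show False
      using small[of \<epsilon> T0] \<open>0 < ereal \<epsilon>\<close> by fastforce
  qed
qed

theorem corollary2p2:
  fixes \<alpha> \<beta> \<gamma> p1 m C :: real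
    and u0 :: "real \<Rightarrow> complex" and v0 :: "real \<Rightarrow> real"
    and u :: "real \<Rightarrow> real \<Rightarrow> complex" and v :: "real \<Rightarrow> real \<Rightarrow> real"
  assumes "\<alpha> < 0" and "\<gamma> < 0"
    and "u0 \<in> H1" and "v0 \<in> H1"
    and "nls_kdv_global_solution \<alpha> \<beta> \<gamma> u0 v0 u v"
    and "0 < p1" and "p1 < 2 / 3"
    and "0 < m" and "m < 1 - p1 / 2"
    and "C > 0"
  shows "Liminf at_top (\<lambda>t. ereal (LINT x:Gamma_region C m p1 t|lborel. (v t x)\<^sup>2)) = 0
    \<and> Liminf at_top (\<lambda>t. ereal (LINT x:Gamma_region C m p1 t|lborel. (cmod (u t x))\<^sup>2)) = 0"
proof -
  have sol: "kdv_eq \<gamma> T u v" "continuous_H1 T u" "continuous_H1 T v" if "T > 0" for T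
    using assms(5) that by (auto simp: nls_kdv_global_solution_def nls_kdv_solution_on_def)
  obtain M where M: "\<And>t. t \<ge> 0 \<Longrightarrow> H1_norm (u t) + H1_norm (v t) \<le> M"
    using assms(5) unfolding nls_kdv_global_solution_def bdd_above_def by auto
  have uM: "l2_norm (u t) \<le> M" and vM: "l2_norm (v t) \<le> M" if "t \<ge> 0" for t
    using M[OF that] l2_norm_le_H1_norm[of "u t"] l2_norm_le_H1_norm[of "v t"]
      l2_norm_nonneg[of "u t"] l2_norm_nonneg[of "v t"] by linarith+
  let ?\<Gamma> = "Gamma_region C m p1"
  have split: "(LINT x:?\<Gamma> t|lborel. (v t x)\<^sup>2 / 2 - \<gamma> * (cmod (u t x))\<^sup>2)
      = (LINT x:?\<Gamma> t|lborel. (v t x)\<^sup>2) / 2 - \<gamma> * (LINT x:?\<Gamma> t|lborel. (cmod (u t x))\<^sup>2)" if "t \<ge> 0" for t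
  proof -
    have "L2 (u t)" "L2 (v t)"
      using continuous_H1_L2[OF sol(2)[of "t + 1"], of t] continuous_H1_L2[OF sol(3)[of "t + 1"], of t] that by auto
    then have int: "integrable lborel (\<lambda>x. (cmod (u t x))\<^sup>2)" "integrable lborel (\<lambda>x. (v t x)\<^sup>2)"
      by (auto simp: L2_def)
    have meas: "?\<Gamma> t \<in> sets lborel" by (simp add: Gamma_region_eq)
    note integrable_mult_indicator[OF meas int(1)] integrable_mult_indicator[OF meas int(2)]
    then show ?thesis
      by (simp add: set_lebesgue_integral_def algebra_simps)
  qed
  have v_nonneg: "(LINT x:?\<Gamma> t|lborel. (v t x)\<^sup>2) \<ge> 0" and u_nonneg: "(LINT x:?\<Gamma> t|lborel. (cmod (u t x))\<^sup>2) \<ge> 0" for t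
    by (simp_all add: set_lebesgue_integral_def)
  have small: "\<exists>t\<ge>T0. (LINT x:?\<Gamma> t|lborel. (v t x)\<^sup>2) / 2 - \<gamma> * (LINT x:?\<Gamma> t|lborel. (cmod (u t x))\<^sup>2) < \<epsilon>"
    if "\<epsilon> > 0" for \<epsilon> T0
  proof -
    obtain t where "t \<ge> max 0 T0" "(LINT x:?\<Gamma> t|lborel. (v t x)\<^sup>2 / 2 - \<gamma> * (cmod (u t x))\<^sup>2) < \<epsilon>"
      using mass_in_moving_window_small[OF sol \<open>\<gamma> < 0\<close> uM vM assms(6-10) \<open>\<epsilon> > 0\<close>, of "max 0 T0"] by blast
    then show ?thesis using split[of t] by auto
  qed
  show ?thesis
  proof
    show "Liminf at_top (\<lambda>t. ereal (LINT x:?\<Gamma> t|lborel. (v t x)\<^sup>2)) = 0"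
    proof (rule Liminf_at_top_eq_0I[OF v_nonneg])
      fix \<epsilon> T0 :: real assume "\<epsilon> > 0"
      then obtain t where "t \<ge> T0"
        "(LINT x:?\<Gamma> t|lborel. (v t x)\<^sup>2) / 2 - \<gamma> * (LINT x:?\<Gamma> t|lborel. (cmod (u t x))\<^sup>2) < \<epsilon> / 2"
        using small[of "\<epsilon> / 2" T0] by auto
      moreover have "\<gamma> * (LINT x:?\<Gamma> t|lborel. (cmod (u t x))\<^sup>2) \<le> 0"
        using \<open>\<gamma> < 0\<close> u_nonneg by (simp add: mult_nonpos_nonneg)
      ultimately have "(LINT x:?\<Gamma> t|lborel. (v t x)\<^sup>2) < \<epsilon>" by linarith
      then show "\<exists>t\<ge>T0. (LINT x:?\<Gamma> t|lborel. (v t x)\<^sup>2) < \<epsilon>"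
        using \<open>t \<ge> T0\<close> by blast
    qed
    show "Liminf at_top (\<lambda>t. ereal (LINT x:?\<Gamma> t|lborel. (cmod (u t x))\<^sup>2)) = 0"
    proof (rule Liminf_at_top_eq_0I[OF u_nonneg])
      fix \<epsilon> T0 :: real assume "\<epsilon> > 0"
      then obtain t where "t \<ge> T0"
        "(LINT x:?\<Gamma> t|lborel. (v t x)\<^sup>2) / 2 - \<gamma> * (LINT x:?\<Gamma> t|lborel. (cmod (u t x))\<^sup>2) < - \<gamma> * \<epsilon>"
        using small[of "- \<gamma> * \<epsilon>" T0] \<open>\<gamma> < 0\<close> by (auto simp: mult_neg_pos)
      then have "- \<gamma> * (LINT x:?\<Gamma> t|lborel. (cmod (u t x))\<^sup>2) < - \<gamma> * \<epsilon>"
        using v_nonneg[of t] by linarith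
      then have "(LINT x:?\<Gamma> t|lborel. (cmod (u t x))\<^sup>2) < \<epsilon>"
        using \<open>\<gamma> < 0\<close> by (simp add: mult_less_cancel_left)
      then show "\<exists>t\<ge>T0. (LINT x:?\<Gamma> t|lborel. (cmod (u t x))\<^sup>2) < \<epsilon>"
        using \<open>t \<ge> T0\<close> by blast
    qed
  qed
qed

end
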